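(* For each positive integer $k$, there are, up to isomorphism, only finitely many connected bipartite graphs with maximum valency at most $k$ which admit local uniform mixing (that is, which have a vertex at which there is local uniform mixing).
   Context: Graphs are finite, simple and undirected. For a graph $X$ with adjacency matrix $A$ let $U(t)=\exp(itA)$ for real $t$; for a vertex $a$ let $D_a=e_ae_a^T$, where $e_a$ is the standard basis vector indexed by $a$, and let $D_a(t)=U(t)D_aU(-t)$. There is local uniform mixing at $a$ if there is a time $t$ such that $D_a(t)\circ I=\frac1n I$, where $n=|V(X)|$ and $\circ$ is the entrywise product. *)

theory Defs
  imports
    Complex_Main
    "Graph_Theory.Graph_Theory"
    "Jordan_Normal_Form.Matrix"
begin

text \<open>
  A finite simple undirected graph is a \<open>pair_graph\<close>: a finite, loop-free, symmetric digraph
  whose arcs are pairs of vertices. The valency of a vertex is therefore its out-degree.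
\<close>

definition bipartite :: "'a pair_pre_digraph \<Rightarrow> bool" where
  "bipartite G \<longleftrightarrow> (\<exists>X Y. pverts G = X \<union> Y \<and> X \<inter> Y = {} \<and> parcs G \<subseteq> X \<times> Y \<union> Y \<times> X)"

definition max_valency :: "'a pair_pre_digraph \<Rightarrow> nat" where
  "max_valency G = Max (out_degree (with_proj G) ` pverts G)"

text \<open>
  Matrices have index set \<open>{0..<n}\<close>, so matrices indexed by vertices are written with respect to
  a list \<open>vs\<close> that enumerates the vertex set without repetition; index \<open>i\<close> stands for the vertex
  \<open>vs ! i\<close>.
\<close>

definition adjacency_mat :: "'a pair_pre_digraph \<Rightarrow> 'a list \<Rightarrow> complex mat" where
  "adjacency_mat G vs = mat (length vs) (length vs)
     (\<lambda>(i, j). if (vs ! i, vs ! j) \<in> parcs G then 1 else 0)"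

text \<open>The exponential series of a square matrix; it converges absolutely in every entry.\<close>

definition mat_exp :: "complex mat \<Rightarrow> complex mat" where
  "mat_exp A = mat (dim_row A) (dim_row A) (\<lambda>(i, j). \<Sum>m. (A ^\<^sub>m m) $$ (i, j) / fact m)"

definition transition_mat :: "'a pair_pre_digraph \<Rightarrow> 'a list \<Rightarrow> real \<Rightarrow> complex mat" where
  "transition_mat G vs t = mat_exp ((\<i> * complex_of_real t) \<cdot>\<^sub>m adjacency_mat G vs)"

text \<open>The outer product \<open>e\<^sub>i e\<^sub>i\<^sup>T\<close>.\<close>

definition vertex_state :: "nat \<Rightarrow> nat \<Rightarrow> complex mat" where
  "vertex_state n i = mat n n (\<lambda>(r, s). unit_vec n i $ r * unit_vec n i $ s)"

definition state_at :: "'a pair_pre_digraph \<Rightarrow> 'a list \<Rightarrow> nat \<Rightarrow> real \<Rightarrow> complex mat" where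
  "state_at G vs i t =
     transition_mat G vs t * vertex_state (length vs) i * transition_mat G vs (- t)"

definition schur_product :: "complex mat \<Rightarrow> complex mat \<Rightarrow> complex mat" where
  "schur_product A B = mat (dim_row A) (dim_col A) (\<lambda>(i, j). A $$ (i, j) * B $$ (i, j))"

text \<open>
  The choice of \<open>vs\<close> is immaterial: another enumeration permutes the rows and columns of all
  matrices simultaneously.
\<close>

definition local_uniform_mixing :: "'a pair_pre_digraph \<Rightarrow> 'a \<Rightarrow> bool" where
  "local_uniform_mixing G a \<longleftrightarrow>
     (\<exists>vs i t. distinct vs \<and> set vs = pverts G \<and> i < length vs \<and> vs ! i = a \<and>
        schur_product (state_at G vs i t) (1\<^sub>m (length vs)) =
          (1 / of_nat (card (pverts G))) \<cdot>\<^sub>m 1\<^sub>m (length vs))"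

definition graph_iso_rel :: "('a pair_pre_digraph \<times> 'a pair_pre_digraph) set" where
  "graph_iso_rel = {(G, H). digraph_iso (with_proj G) (with_proj H)}"

end

theory Submission
  imports Defs "HOL-Complex_Analysis.Conformal_Mappings" "HOL-Real_Asymp.Real_Asymp"
    "HOL-Computational_Algebra.Fundamental_Theorem_Algebra" "Jordan_Normal_Form.Determinant"
begin

text \<open>
  Write \<open>U(t) = exp(itA)\<close> and let \<open>n\<close> be the number of vertices. Local uniform mixing at \<open>a\<close> says that
  \<open>\<bar>U(t)\<^sub>b\<^sub>a\<bar>\<^sup>2 = 1/n\<close> for every vertex \<open>b\<close>. In a bipartite graph all walks from \<open>a\<close> to \<open>b\<close> have lengths of the
  same parity, so \<open>U(t)\<^sub>b\<^sub>a\<close> is real or purely imaginary and its square is \<open>1/n\<close> or \<open>-1/n\<close>; in particular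
  it is algebraic. Let \<open>v\<close> be an eigenvector for \<open>\<theta>\<close> with \<open>v\<^sub>a \<noteq> 0\<close>. Then
  \<open>(\<Sum>b. v\<^sub>b U(t)\<^sub>b\<^sub>a) = exp(it\<theta>) v\<^sub>a\<close>, and \<open>v\<close> can be chosen with algebraic entries, so \<open>exp(it\<theta>)\<close> is
  algebraic for every \<open>\<theta>\<close> in the eigenvalue support of \<open>a\<close>. If \<open>t \<noteq> 0\<close>, the Gelfond-Schneider theorem
  forces the ratios of nonzero eigenvalues in the support to be rational; if \<open>t = 0\<close>, then \<open>n = 1\<close>.
  
  The support is the set of roots of the minimal polynomial of the vector \<open>e\<^sub>a\<close> with respect to \<open>A\<close>. This
  polynomial has rational coefficients and simple real roots, so the product of its nonzero roots is
  rational. As these roots are rational multiples of each other, there is an \<open>s\<close> such that every \<open>\<theta>\<^sup>s\<close> is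
  rational, and it is even an integer (\<open>eigenvalue_rational_power_int\<close>). Two distinct real numbers with
  rational ratio whose \<open>s\<close>-th powers are integers are at distance at least 1
  (\<open>gap_of_commensurable_radicals\<close>). All eigenvalues lie in \<open>[-k, k]\<close>, so the support has at most
  \<open>2k + 1\<close> elements. The degree of the minimal polynomial exceeds the distance from \<open>a\<close> to any other
  vertex, and a ball of bounded radius in a graph of maximum valency \<open>k\<close> has boundedly many vertices. There
  are finitely many graphs of bounded order up to isomorphism.
  
  The Gelfond-Schneider theorem is proved by Schneider's method, in the symmetric form: if \<open>b\<^sub>1, b\<^sub>2\<close> are
  algebraic and linearly independent over the rationals and \<open>s \<noteq> 0\<close>, then \<open>exp(s b\<^sub>1)\<close> and \<open>exp(s b\<^sub>2)\<close>
  are not both algebraic. Otherwise Siegel's lemma (\<open>siegel\<close>) gives a nonzero polynomial in \<open>z\<close> and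
  \<open>exp(sz)\<close> with small integer coefficients that vanishes at many points \<open>a b\<^sub>1 + r b\<^sub>2\<close>. At the next such
  points its value is tiny, because an entire function of moderate growth with many zeros is small
  (\<open>schwarz_many_zeros\<close>), and it is an algebraic number of controlled size, hence not tiny unless it is 0
  (\<open>liouville\<close>). By induction it vanishes at all the points \<open>a b\<^sub>1 + r b\<^sub>2\<close>, which is too many: it vanishes
  identically, and this contradicts the algebraic independence of \<open>z\<close> and \<open>exp(sz)\<close>.
\<close>

section \<open>Algebraic numbers and finite-dimensional rational algebras\<close>

interpretation rat_vs: vector_space "\<lambda>(q::rat) (z::complex). of_rat q * z"
  by unfold_locales (auto simp: algebra_simps of_rat_add of_rat_mult)

text \<open>
  A product is bilinear over the rationals, so it suffices to look at products of generators.
\<close>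

lemma rat_span_mult:
  assumes "\<And>a b. a \<in> A \<Longrightarrow> b \<in> B \<Longrightarrow> a * b \<in> rat_vs.span C"
    and "x \<in> rat_vs.span A" "y \<in> rat_vs.span B"
  shows "x * y \<in> rat_vs.span C"
proof -
  have 1: "a * y \<in> rat_vs.span C" if "a \<in> A" for a
    using assms(3)
  proof (induction rule: rat_vs.span_induct_alt)
    case base show ?case by (simp add: rat_vs.span_zero)
  next
    case (step q b z)
    have "a * (of_rat q * b + z) = of_rat q * (a * b) + a * z" by (simp add: algebra_simps)
    then show ?case
      using rat_vs.span_add[OF rat_vs.span_scale[OF assms(1)[OF that step(1)], of q] step(2)] by simp
  qed
  show ?thesis using assms(2)
  proof (induction rule: rat_vs.span_induct_alt)
    case base show ?case by (simp add: rat_vs.span_zero)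
  next
    case (step q a z)
    have "(of_rat q * a + z) * y = of_rat q * (a * y) + z * y" by (simp add: algebra_simps)
    then show ?case
      using rat_vs.span_add[OF rat_vs.span_scale[OF 1[OF step(1)], of q] step(2)] by simp
  qed
qed

text \<open>
  Instead of number fields, the argument uses finite sets whose rational span is a subring of the complex
  numbers. An element of such a span is algebraic, and any finitely many algebraic numbers lie in
  one; this gives the closure of the algebraic numbers under sums and products, and later a basis with
  respect to which sizes are measured.
\<close>

definition finite_rat_algebra :: "complex set \<Rightarrow> bool" where
  "finite_rat_algebra S \<longleftrightarrow> finite S \<and> 1 \<in> rat_vs.span S \<and>
     (\<forall>x \<in> rat_vs.span S. \<forall>y \<in> rat_vs.span S. x * y \<in> rat_vs.span S)"

lemma finite_rat_algebra_one: "finite_rat_algebra {1}"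
proof -
  have "x * y \<in> rat_vs.span {1}" if "x \<in> rat_vs.span {1}" "y \<in> rat_vs.span {1}" for x y
    by (rule rat_span_mult[OF _ that]) (auto intro: rat_vs.span_base)
  then show ?thesis by (auto simp: finite_rat_algebra_def intro: rat_vs.span_base)
qed

text \<open>
  A polynomial relation for \<open>x\<close> of degree \<open>n\<close> expresses \<open>x\<^sup>n\<close> by lower powers, so multiplication by \<open>x\<close>
  preserves the span of the powers below \<open>n\<close>.
\<close>

lemma algebraic_power_in_span:
  assumes "algebraic (x::complex)"
  obtains n where "\<And>m. x ^ m \<in> rat_vs.span ((\<lambda>i. x ^ i) ` {..<n})"
proof -
  obtain p where p: "\<And>i. coeff p i \<in> \<int>" "p \<noteq> 0" "poly p x = 0"
    using assms by (auto elim!: algebraicE)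
  define n where "n = degree p"
  define V where "V = rat_vs.span ((\<lambda>i. x ^ i) ` {..<n})"
  have "\<forall>i. \<exists>k. coeff p i = of_int k" using p(1) by (auto elim: Ints_cases)
  then obtain c where c: "\<And>i. coeff p i = of_int (c i)" by metis
  have c0: "c n \<noteq> 0" using p(2) c[of n] by (auto simp: n_def)
  have "(\<Sum>i<n. of_int (c i) * x ^ i) + of_int (c n) * x ^ n = 0"
    using p(3) by (simp add: poly_altdef c n_def flip: lessThan_Suc_atMost)
  then have "of_int (c n) * x ^ n = - (\<Sum>i<n. of_int (c i) * x ^ i)" by (simp add: add_eq_0_iff)
  then have "x ^ n = of_rat (- 1 / of_int (c n)) * (\<Sum>i<n. of_rat (of_int (c i)) * x ^ i)"
    using c0 by (simp add: of_rat_divide of_rat_minus field_simps)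
  also have "\<dots> \<in> V" unfolding V_def
    by (intro rat_vs.span_scale rat_vs.span_sum rat_vs.span_base) auto
  finally have n: "x ^ n \<in> V" .
  have step: "x * v \<in> V" if "v \<in> V" for v
    using that unfolding V_def
  proof (induction rule: rat_vs.span_induct_alt)
    case base show ?case by (simp add: rat_vs.span_zero)
  next
    case (step q a z)
    then obtain i where i: "i < n" "a = x ^ i" by auto
    have "x * a \<in> V"
    proof (cases "Suc i < n")
      case True then show ?thesis using i by (auto simp: V_def intro!: rat_vs.span_base image_eqI[of _ _ "Suc i"])
    next
      case False
      then have "Suc i = n" using i by simp
      then show ?thesis using n i by (metis power_Suc)
    qed
    moreover have "x * (of_rat q * a + z) = of_rat q * (x * a) + x * z" by (simp add: algebra_simps)
    ultimately show ?case
      using step rat_vs.span_add[OF rat_vs.span_scale, of "x * a" _ "x * z" q] unfolding V_def by simp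
  qed
  have n0: "n \<noteq> 0"
  proof
    assume "n = 0"
    then have "poly p x = coeff p 0" by (simp add: n_def poly_altdef)
    then show False using p c0 \<open>n = 0\<close> c by simp
  qed
  have "x ^ m \<in> V" for m
  proof (induction m)
    case 0 then show ?case using n0 by (auto simp: V_def intro!: rat_vs.span_base image_eqI[of _ _ 0])
  next
    case (Suc m) then show ?case using step by simp
  qed
  then show ?thesis using that V_def by blast
qed

lemma finite_rat_algebra_extend:
  assumes S: "finite_rat_algebra S" and x: "algebraic x"
  shows "\<exists>S'. finite_rat_algebra S' \<and> rat_vs.span S \<subseteq> rat_vs.span S' \<and> x \<in> rat_vs.span S'"
proof -
  obtain n where n: "\<And>m. x ^ m \<in> rat_vs.span ((\<lambda>i. x ^ i) ` {..<n})"
    using algebraic_power_in_span[OF x] by blast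
  define S' where "S' = (\<lambda>(s, i). s * x ^ i) ` (S \<times> {..<n})"
  have mem: "s * x ^ m \<in> rat_vs.span S'" if "s \<in> rat_vs.span S" for s m
    by (rule rat_span_mult[OF _ that n]) (auto simp: S'_def intro!: rat_vs.span_base)
  have closed: "u * v \<in> rat_vs.span S'" if "u \<in> rat_vs.span S'" "v \<in> rat_vs.span S'" for u v
  proof (rule rat_span_mult[OF _ that])
    fix a b assume "a \<in> S'" "b \<in> S'"
    then obtain s i t j where *: "s \<in> S" "t \<in> S" "a = s * x ^ i" "b = t * x ^ j"
      unfolding S'_def by auto
    have "a * b = (s * t) * x ^ (i + j)" using * by (simp add: power_add)
    moreover have "s * t \<in> rat_vs.span S"
      using S * by (auto simp: finite_rat_algebra_def intro: rat_vs.span_base)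
    ultimately show "a * b \<in> rat_vs.span S'" using mem by metis
  qed
  have "1 \<in> rat_vs.span S" using S by (simp add: finite_rat_algebra_def)
  then have "x \<in> rat_vs.span S'" using mem[of 1 1] by simp
  moreover have sub: "rat_vs.span S \<subseteq> rat_vs.span S'" using mem[of _ 0] by auto
  moreover have "finite S'" using S by (auto simp: S'_def finite_rat_algebra_def)
  moreover have "1 \<in> rat_vs.span S'" using sub \<open>1 \<in> rat_vs.span S\<close> by blast
  ultimately have "finite_rat_algebra S'"
    unfolding finite_rat_algebra_def using closed by blast
  then show ?thesis using sub \<open>x \<in> rat_vs.span S'\<close> by blast
qed

lemma finite_rat_algebra_exists:
  assumes "finite X" "\<And>x. x \<in> X \<Longrightarrow> algebraic x"
  shows "\<exists>S. finite_rat_algebra S \<and> X \<subseteq> rat_vs.span S"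
  using assms
proof (induction X rule: finite_induct)
  case empty then show ?case using finite_rat_algebra_one by auto
next
  case (insert x X)
  then obtain S where "finite_rat_algebra S" "X \<subseteq> rat_vs.span S" by auto
  then show ?case using finite_rat_algebra_extend[of S x] insert.prems by blast
qed

lemma finite_rat_algebra_mult:
  "finite_rat_algebra S \<Longrightarrow> x \<in> rat_vs.span S \<Longrightarrow> y \<in> rat_vs.span S \<Longrightarrow> x * y \<in> rat_vs.span S"
  by (simp add: finite_rat_algebra_def)

text \<open>
  The \<open>n + 1\<close> powers \<open>x\<^sup>0, ..., x\<^sup>n\<close> lie in a space spanned by \<open>n\<close> elements, so there is a linear relation
  between them.
\<close>

lemma finite_rat_algebra_algebraic:
  assumes S: "finite_rat_algebra S" and x: "x \<in> rat_vs.span S"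
  shows "algebraic x"
proof -
  define n where "n = card S"
  define P where "P = (\<lambda>i. x ^ i) ` {..n}"
  have pow: "x ^ i \<in> rat_vs.span S" for i
  proof (induction i)
    case 0 then show ?case using S by (simp add: finite_rat_algebra_def)
  next
    case (Suc i) then show ?case using finite_rat_algebra_mult[OF S x] by simp
  qed
  show ?thesis
  proof (cases "inj_on (\<lambda>i. x ^ i) {..n}")
    case False
    then obtain i j where ij: "i \<noteq> j" "x ^ i = x ^ j" by (auto simp: inj_on_def)
    define p :: "complex poly" where "p = monom 1 i - monom 1 j"
    have "coeff p i = 1" using ij by (simp add: p_def)
    then have "p \<noteq> 0" by auto
    then show ?thesis using ij by (intro algebraicI[of p]) (auto simp: p_def poly_monom)
  next
    case True
    then have "card P = Suc n" by (simp add: P_def card_image)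
    moreover have "finite S" using S by (simp add: finite_rat_algebra_def)
    moreover have "P \<subseteq> rat_vs.span S" using pow by (auto simp: P_def)
    ultimately have "rat_vs.dependent P"
      using rat_vs.independent_span_bound[of S P] by (auto simp: n_def)
    moreover have "finite P" by (simp add: P_def)
    ultimately obtain u where u: "\<exists>v\<in>P. u v \<noteq> 0" "(\<Sum>v\<in>P. of_rat (u v) * v) = 0"
      using rat_vs.dependent_finite[of P] by blast
    define p :: "complex poly" where "p = (\<Sum>i\<le>n. monom (of_rat (u (x ^ i))) i)"
    have co: "coeff p i = (if i \<le> n then of_rat (u (x ^ i)) else 0)" for i
      by (simp add: p_def coeff_sum)
    obtain i where "i \<le> n" "u (x ^ i) \<noteq> 0" using u(1) by (auto simp: P_def)
    then have "coeff p i \<noteq> 0" by (simp add: co)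
    then have "p \<noteq> 0" by auto
    moreover have "poly p x = 0"
      using u(2) True by (simp add: p_def poly_sum poly_monom P_def sum.reindex)
    ultimately show ?thesis by (intro algebraicI'[of p]) (auto simp: co)
  qed
qed

lemma algebraic_closed:
  fixes x y :: complex
  assumes "algebraic x" "algebraic y"
  shows algebraic_add: "algebraic (x + y)" and algebraic_mult: "algebraic (x * y)"
proof -
  obtain S where S: "finite_rat_algebra S" "{x, y} \<subseteq> rat_vs.span S"
    using finite_rat_algebra_exists[of "{x, y}"] assms by auto
  have "x \<in> rat_vs.span S" "y \<in> rat_vs.span S" using S(2) by auto
  then have "x + y \<in> rat_vs.span S" "x * y \<in> rat_vs.span S"
    using finite_rat_algebra_mult[OF S(1)] rat_vs.span_add by blast+
  then show "algebraic (x + y)" "algebraic (x * y)"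
    using finite_rat_algebra_algebraic[OF S(1)] by blast+
qed

lemma algebraic_sum:
  "(\<And>i. i \<in> I \<Longrightarrow> algebraic (f i :: complex)) \<Longrightarrow> algebraic (sum f I)"
  by (induction I rule: infinite_finite_induct) (auto intro: algebraic_add)

lemma common_denominator:
  fixes r :: "'i \<Rightarrow> rat"
  assumes "finite I"
  shows "\<exists>D::int. D > 0 \<and> (\<forall>i\<in>I. of_int D * r i \<in> \<int>)"
  using assms
proof (induction I rule: finite_induct)
  case empty then show ?case by (auto intro: exI[of _ 1])
next
  case (insert i I)
  then obtain D where D: "D > 0" "\<forall>i\<in>I. of_int D * r i \<in> \<int>" by auto
  obtain a b where "quotient_of (r i) = (a, b)" by (metis surj_pair)
  then have ab: "r i = of_int a / of_int b" "b > 0"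
    using quotient_of_div quotient_of_denom_pos by blast+
  have "of_int (D * b) * r j \<in> \<int>" if "j \<in> insert i I" for j
  proof (cases "j = i")
    case True
    then have "of_int (D * b) * r j = of_int (D * a)" using ab by simp
    then show ?thesis by (metis Ints_of_int)
  next
    case False
    then have "of_int D * r j \<in> \<int>" using D(2) that by blast
    then have "of_int b * (of_int D * r j) \<in> \<int>" by (rule Ints_mult[OF Ints_of_int])
    moreover have "of_int (D * b) * r j = of_int b * (of_int D * r j)" by simp
    ultimately show ?thesis by metis
  qed
  then show ?case using D ab by (intro exI[of _ "D * b"]) simp
qed

section \<open>Orders and the Liouville inequality\<close>

text \<open>
  The integer combinations of the \<open>w i\<close> form an order (a lattice that is closed under multiplication) in a
  number field; the structure constants \<open>c\<close> are integers. It need not contain 1, which is harmless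
  because some positive integer always lies in it.
\<close>

locale int_order =
  fixes d :: nat and w :: "nat \<Rightarrow> complex" and c :: "nat \<Rightarrow> nat \<Rightarrow> nat \<Rightarrow> int"
  assumes indep: "\<And>x. (\<Sum>i<d. of_int (x i) * w i) = 0 \<Longrightarrow> i < d \<Longrightarrow> x i = (0::int)"
    and mult: "\<And>i j. i < d \<Longrightarrow> j < d \<Longrightarrow> w i * w j = (\<Sum>k<d. of_int (c i j k) * w k)"

text \<open>
  Multiplying a rational basis of a finite-dimensional algebra by a common denominator of its structure
  constants makes the structure constants integral.
\<close>

lemma int_order_exists:
  fixes X :: "complex set"
  assumes "finite X" "\<And>x. x \<in> X \<Longrightarrow> algebraic x"
  shows "\<exists>d w c. int_order d w c \<and>
    (\<forall>x\<in>X. \<exists>q>0::int. \<exists>y. of_int q * x = (\<Sum>i<d. of_int (y i) * w i))"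
proof -
  obtain S where S: "finite_rat_algebra S" "X \<subseteq> rat_vs.span S"
    using finite_rat_algebra_exists[OF assms] by auto
  obtain B where B: "B \<subseteq> rat_vs.span S" "rat_vs.independent B" "rat_vs.span S \<subseteq> rat_vs.span B"
    using rat_vs.basis_exists[of "rat_vs.span S"] by metis
  have fB: "finite B"
    using rat_vs.independent_span_bound[of S B] S(1) B unfolding finite_rat_algebra_def by blast
  obtain f where f: "bij_betw f {..<card B} B"
    using ex_bij_betw_nat_finite[OF fB] by (auto simp: atLeast0LessThan)
  define d where "d = card B"
  have inj: "inj_on f {..<d}" and im: "f ` {..<d} = B" using f by (auto simp: bij_betw_def d_def)
  have sumB: "(\<Sum>v\<in>B. g v) = (\<Sum>i<d. g (f i))" for g :: "complex \<Rightarrow> complex"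
    using sum.reindex_bij_betw[OF f, of g] by (simp add: d_def)
  have rep: "\<exists>r. x = (\<Sum>k<d. of_rat (r k) * f k)" if "x \<in> rat_vs.span S" for x
  proof -
    have "x \<in> rat_vs.span B" using that B by auto
    then obtain u where "x = (\<Sum>v\<in>B. of_rat (u v) * v)" using rat_vs.span_finite[OF fB] by auto
    then have "x = (\<Sum>k<d. of_rat (u (f k)) * f k)" by (simp add: sumB)
    then show ?thesis by (rule exI[of _ "\<lambda>k. u (f k)"])
  qed
  have fS: "f i \<in> rat_vs.span S" if "i < d" for i using im B that by blast
  have "\<exists>r. f i * f j = (\<Sum>k<d. of_rat (r k) * f k)" if "i < d" "j < d" for i j
    using rep[of "f i * f j"] S(1) fS that by (auto simp: finite_rat_algebra_def)
  then obtain r where r: "\<And>i j. i < d \<Longrightarrow> j < d \<Longrightarrow> f i * f j = (\<Sum>k<d. of_rat (r i j k) * f k)"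
    by metis
  obtain D :: int where D: "D > 0" "\<And>i j k. i < d \<Longrightarrow> j < d \<Longrightarrow> k < d \<Longrightarrow> of_int D * r i j k \<in> \<int>"
    using common_denominator[of "{..<d} \<times> {..<d} \<times> {..<d}" "\<lambda>(i,j,k). r i j k"] by auto
  define w where "w = (\<lambda>i. of_int D * f i)"
  define c where "c = (\<lambda>i j k. \<lfloor>of_int D * r i j k\<rfloor>)"
  have c: "of_int (c i j k) = (of_rat (of_int D * r i j k) :: complex)" if "i < d" "j < d" "k < d" for i j k
    using D(2)[OF that] by (auto simp: c_def elim!: Ints_cases)
  have "int_order d w c"
  proof
    fix x :: "nat \<Rightarrow> int" and i
    assume x: "(\<Sum>i<d. of_int (x i) * w i) = 0" and "i < d"
    define u where "u = (\<lambda>v. of_int (x (inv_into {..<d} f v)) :: rat)"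
    have "(\<Sum>v\<in>B. of_rat (u v) * v) = (\<Sum>i<d. of_int (x i) * f i)"
      by (simp add: sumB u_def inj)
    also have "of_int D * \<dots> = 0" using x by (simp add: w_def sum_distrib_left algebra_simps)
    finally have "(\<Sum>v\<in>B. of_rat (u v) * v) = 0" using D by simp
    then have "u (f i) = 0" using B(2) fB im \<open>i < d\<close> rat_vs.dependent_finite[OF fB] by blast
    then show "x i = 0" using \<open>i < d\<close> by (simp add: u_def inj)
  next
    fix i j assume ij: "i < d" "j < d"
    have "w i * w j = of_int D * of_int D * (f i * f j)" by (simp add: w_def)
    also have "\<dots> = (\<Sum>k<d. of_rat (of_int D * r i j k) * w k)"
      by (simp add: r[OF ij] w_def sum_distrib_left of_rat_mult algebra_simps)
    also have "\<dots> = (\<Sum>k<d. of_int (c i j k) * w k)" using c ij by simp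
    finally show "w i * w j = (\<Sum>k<d. of_int (c i j k) * w k)" .
  qed
  moreover have "\<exists>q>0::int. \<exists>y. of_int q * x = (\<Sum>i<d. of_int (y i) * w i)" if "x \<in> X" for x
  proof -
    have "x \<in> rat_vs.span S" using S(2) that by blast
    then obtain s where s: "x = (\<Sum>k<d. of_rat (s k) * f k)" using rep by metis
    obtain E :: int where E: "E > 0" "\<And>k. k < d \<Longrightarrow> of_int E * s k \<in> \<int>"
      using common_denominator[of "{..<d}" s] by auto
    define y where "y = (\<lambda>k. \<lfloor>of_int E * s k\<rfloor>)"
    have y: "of_int (y k) = (of_rat (of_int E * s k) :: complex)" if "k < d" for k
      using E(2)[OF that] by (auto simp: y_def elim!: Ints_cases)
    have "of_int (E * D) * x = (\<Sum>k<d. of_rat (of_int E * s k) * w k)"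
      by (simp add: s w_def sum_distrib_left of_rat_mult algebra_simps)
    also have "\<dots> = (\<Sum>k<d. of_int (y k) * w k)" using y by simp
    finally show ?thesis using E D by (intro exI[of _ "E * D"]) auto
  qed
  ultimately show ?thesis by blast
qed

text \<open>
  The trivial bound from the Leibniz formula is enough: the inequality of Liouville below is needed only up
  to the value of the exponent of the height.
\<close>

lemma det_int_bound:
  fixes A :: "int mat"
  assumes A: "A \<in> carrier_mat n n" and E: "\<And>i j. i < n \<Longrightarrow> j < n \<Longrightarrow> real_of_int \<bar>A $$ (i, j)\<bar> \<le> E"
  shows "real_of_int \<bar>det A\<bar> \<le> fact n * E ^ n"
proof -
  have "real_of_int \<bar>det A\<bar> = \<bar>\<Sum>p | p permutes {0..<n}. of_int (signof p) * (\<Prod>i = 0..<n. real_of_int (A $$ (i, p i)))\<bar>"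
    by (simp add: det_def'[OF A])
  also have "\<dots> \<le> (\<Sum>p | p permutes {0..<n}. \<Prod>i = 0..<n. real_of_int \<bar>A $$ (i, p i)\<bar>)"
    by (rule order_trans[OF sum_abs]) (auto intro!: sum_mono simp: abs_mult abs_prod sign_def)
  also have "\<dots> \<le> (\<Sum>p | p permutes {0..<n}. \<Prod>i = 0..<n. E)"
    using permutes_in_image by (intro sum_mono prod_mono) (fastforce intro!: E)
  also have "\<dots> = fact n * E ^ n"
    by (simp add: card_permutations)
  finally show ?thesis .
qed

lemma sum_rotate3:
  "(\<Sum>k\<in>C. \<Sum>i\<in>A. \<Sum>j\<in>B. g i j k) = (\<Sum>i\<in>A. \<Sum>j\<in>B. \<Sum>k\<in>C. g i j k :: 'b :: comm_monoid_add)"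
proof -
  have "(\<Sum>k\<in>C. \<Sum>i\<in>A. \<Sum>j\<in>B. g i j k) = (\<Sum>i\<in>A. \<Sum>k\<in>C. \<Sum>j\<in>B. g i j k)" by (rule sum.swap)
  also have "\<dots> = (\<Sum>i\<in>A. \<Sum>j\<in>B. \<Sum>k\<in>C. g i j k)" by (intro sum.cong refl sum.swap)
  finally show ?thesis .
qed

context int_order
begin

text \<open>
  \<open>lat H x\<close> says that \<open>x\<close> lies in the order and that its coordinates have absolute sum at most \<open>H\<close>. This
  plays the part of a height: it is subadditive, and submultiplicative up to the factor \<open>mult_const\<close>.
\<close>

definition lat :: "real \<Rightarrow> complex \<Rightarrow> bool" where
  "lat H x \<longleftrightarrow> (\<exists>y::nat \<Rightarrow> int. x = (\<Sum>i<d. of_int (y i) * w i) \<and> (\<Sum>i<d. real_of_int \<bar>y i\<bar>) \<le> H)"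

definition mult_const :: real where
  "mult_const = 1 + (\<Sum>i<d. \<Sum>j<d. \<Sum>k<d. real_of_int \<bar>c i j k\<bar>)"

lemma mult_const_ge_1: "mult_const \<ge> 1"
  by (simp add: mult_const_def sum_nonneg)

lemma lat_nonneg: "lat H x \<Longrightarrow> H \<ge> 0"
  unfolding lat_def by (meson order_trans sum_nonneg abs_ge_zero of_int_0_le_iff)

lemma lat_mono: "lat H x \<Longrightarrow> H \<le> H' \<Longrightarrow> lat H' x"
  unfolding lat_def by force

lemma lat_zero: "lat 0 0"
  unfolding lat_def by (rule exI[of _ "\<lambda>_. 0"]) simp

lemma lat_add:
  assumes "lat H x" "lat H' x'"
  shows "lat (H + H') (x + x')"
proof -
  obtain y y' where y: "x = (\<Sum>i<d. of_int (y i) * w i)" "(\<Sum>i<d. real_of_int \<bar>y i\<bar>) \<le> H"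
    and y': "x' = (\<Sum>i<d. of_int (y' i) * w i)" "(\<Sum>i<d. real_of_int \<bar>y' i\<bar>) \<le> H'"
    using assms unfolding lat_def by auto
  have "(\<Sum>i<d. real_of_int \<bar>y i + y' i\<bar>) \<le> (\<Sum>i<d. real_of_int \<bar>y i\<bar> + real_of_int \<bar>y' i\<bar>)"
    by (intro sum_mono) auto
  then have "(\<Sum>i<d. real_of_int \<bar>y i + y' i\<bar>) \<le> H + H'"
    using y(2) y'(2) by (simp add: sum.distrib)
  then show ?thesis unfolding lat_def
    by (intro exI[of _ "\<lambda>i. y i + y' i"]) (simp add: y(1) y'(1) sum.distrib algebra_simps)
qed

lemma lat_scale:
  assumes "lat H x"
  shows "lat (real_of_int \<bar>n\<bar> * H) (of_int n * x)"
proof -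
  obtain y where y: "x = (\<Sum>i<d. of_int (y i) * w i)" "(\<Sum>i<d. real_of_int \<bar>y i\<bar>) \<le> H"
    using assms unfolding lat_def by auto
  have "(\<Sum>i<d. real_of_int \<bar>n * y i\<bar>) = real_of_int \<bar>n\<bar> * (\<Sum>i<d. real_of_int \<bar>y i\<bar>)"
    by (simp add: abs_mult sum_distrib_left)
  also have "\<dots> \<le> real_of_int \<bar>n\<bar> * H" using y(2) by (intro mult_left_mono) auto
  finally show ?thesis unfolding lat_def
    by (intro exI[of _ "\<lambda>i. n * y i"]) (simp add: y(1) sum_distrib_left mult.assoc)
qed

lemma lat_sum:
  "(\<And>i. i \<in> I \<Longrightarrow> lat (H i) (f i)) \<Longrightarrow> lat (sum H I) (sum f I)"
  by (induction I rule: infinite_finite_induct) (auto intro: lat_zero lat_add)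

lemma sum_c_le: "i < d \<Longrightarrow> j < d \<Longrightarrow> (\<Sum>k<d. real_of_int \<bar>c i j k\<bar>) \<le> mult_const"
proof -
  assume "i < d" "j < d"
  then have "(\<Sum>k<d. real_of_int \<bar>c i j k\<bar>) \<le> (\<Sum>j<d. \<Sum>k<d. real_of_int \<bar>c i j k\<bar>)"
    by (intro member_le_sum[of j "{..<d}" "\<lambda>j. \<Sum>k<d. real_of_int \<bar>c i j k\<bar>"]) (auto simp: sum_nonneg)
  also have "\<dots> \<le> (\<Sum>i<d. \<Sum>j<d. \<Sum>k<d. real_of_int \<bar>c i j k\<bar>)"
    using \<open>i < d\<close> by (intro member_le_sum[of i "{..<d}" "\<lambda>i. \<Sum>j<d. \<Sum>k<d. real_of_int \<bar>c i j k\<bar>"]) (auto simp: sum_nonneg)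
  finally show ?thesis by (simp add: mult_const_def)
qed

lemma lat_mult:
  assumes "lat H x" "lat H' x'"
  shows "lat (mult_const * H * H') (x * x')"
proof -
  obtain y y' where y: "x = (\<Sum>i<d. of_int (y i) * w i)" "(\<Sum>i<d. real_of_int \<bar>y i\<bar>) \<le> H"
    and y': "x' = (\<Sum>i<d. of_int (y' i) * w i)" "(\<Sum>i<d. real_of_int \<bar>y' i\<bar>) \<le> H'"
    using assms unfolding lat_def by auto
  define z where "z = (\<lambda>k. \<Sum>i<d. \<Sum>j<d. y i * y' j * c i j k)"
  have "x * x' = (\<Sum>i<d. \<Sum>j<d. (of_int (y i) * of_int (y' j)) * (w i * w j))"
    unfolding y(1) y'(1) sum_product by (intro sum.cong refl) (simp add: ac_simps)
  also have "\<dots> = (\<Sum>i<d. \<Sum>j<d. \<Sum>k<d. of_int (y i * y' j * c i j k) * w k)"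
    by (simp add: mult sum_distrib_left mult.assoc)
  also have "\<dots> = (\<Sum>k<d. \<Sum>i<d. \<Sum>j<d. of_int (y i * y' j * c i j k) * w k)"
    by (rule sum_rotate3[symmetric])
  also have "\<dots> = (\<Sum>k<d. of_int (z k) * w k)" by (simp add: z_def sum_distrib_right)
  finally have xx: "x * x' = (\<Sum>k<d. of_int (z k) * w k)" .
  have "(\<Sum>k<d. real_of_int \<bar>z k\<bar>) \<le> (\<Sum>k<d. \<Sum>i<d. \<Sum>j<d. real_of_int \<bar>y i\<bar> * real_of_int \<bar>y' j\<bar> * real_of_int \<bar>c i j k\<bar>)"
  proof (rule sum_mono)
    fix k
    have "\<bar>z k\<bar> \<le> (\<Sum>i<d. \<Sum>j<d. \<bar>y i * y' j * c i j k\<bar>)"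
      unfolding z_def by (rule order_trans[OF sum_abs]) (intro sum_mono sum_abs)
    then have "real_of_int \<bar>z k\<bar> \<le> real_of_int (\<Sum>i<d. \<Sum>j<d. \<bar>y i * y' j * c i j k\<bar>)" by (simp only: of_int_le_iff)
    then show "real_of_int \<bar>z k\<bar> \<le> (\<Sum>i<d. \<Sum>j<d. real_of_int \<bar>y i\<bar> * real_of_int \<bar>y' j\<bar> * real_of_int \<bar>c i j k\<bar>)"
      by (simp add: abs_mult)
  qed
  also have "\<dots> = (\<Sum>i<d. \<Sum>j<d. real_of_int \<bar>y i\<bar> * real_of_int \<bar>y' j\<bar> * (\<Sum>k<d. real_of_int \<bar>c i j k\<bar>))"
    unfolding sum_distrib_left by (rule sum_rotate3)
  also have "\<dots> \<le> (\<Sum>i<d. \<Sum>j<d. real_of_int \<bar>y i\<bar> * real_of_int \<bar>y' j\<bar> * mult_const)"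
    by (intro sum_mono mult_left_mono sum_c_le) auto
  also have "\<dots> = mult_const * (\<Sum>i<d. real_of_int \<bar>y i\<bar>) * (\<Sum>j<d. real_of_int \<bar>y' j\<bar>)"
    unfolding mult.assoc sum_product by (simp add: sum_distrib_left ac_simps)
  also have "\<dots> \<le> mult_const * H * H'"
    using y(2) y'(2) mult_const_ge_1 lat_nonneg[OF assms(1)]
    by (intro mult_mono) (auto simp: sum_nonneg intro!: mult_nonneg_nonneg)
  finally show ?thesis using xx unfolding lat_def by blast
qed

text \<open>
  The factor \<open>e\<close> keeps the statement meaningful for \<open>n = 0\<close>, where \<open>x\<^sup>n = 1\<close> may be outside the order.
\<close>

lemma lat_mult_power:
  assumes "lat h e" "lat H x"
  shows "lat (h * (mult_const * H) ^ n) (e * x ^ n)"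
proof (induction n)
  case 0 then show ?case using assms by simp
next
  case (Suc n)
  from lat_mult[OF this assms(2)] show ?case by (simp add: algebra_simps)
qed

text \<open>
  Multiplication by \<open>x \<noteq> 0\<close> acts on the order by an integer matrix \<open>M\<close>, which is injective and therefore has
  a determinant of absolute value at least 1. The vector \<open>w\<close> satisfies \<open>M w = x w\<close>, so
  \<open>det M w = adj M (M w) = x (adj M w)\<close>. The entries of the adjugate are bounded by a power of the size of
  \<open>x\<close>, so \<open>x\<close> cannot be too small.
\<close>

lemma liouville:
  "\<exists>\<kappa>>0. \<forall>H x. lat H x \<longrightarrow> x \<noteq> 0 \<longrightarrow> H \<ge> 1 \<longrightarrow> norm x \<ge> \<kappa> / H ^ d"
proof (cases "d = 0")
  case True
  then have "x = 0" if "lat H x" for H x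
  proof -
    from that obtain y :: "nat \<Rightarrow> int" where "x = (\<Sum>i<d. of_int (y i) * w i)" unfolding lat_def by blast
    then show ?thesis using True by simp
  qed
  then show ?thesis by (intro exI[of _ 1]) auto
next
  case False
  define W where "W = (\<Sum>k<d. norm (w k))"
  have w0: "w 0 \<noteq> 0"
  proof
    assume "w 0 = 0"
    then have "(\<Sum>i<d. of_int (if i = 0 then 1 else 0) * w i) = 0"
      by (intro sum.neutral) auto
    from indep[OF this, of 0] False show False by simp
  qed
  have W: "W \<ge> norm (w 0)" unfolding W_def
    using False by (intro member_le_sum[of 0 "{..<d}" "\<lambda>k. norm (w k)"]) auto
  then have W0: "W > 0" using w0 zero_less_norm_iff[of "w 0"] by linarith
  define \<kappa> where "\<kappa> = norm (w 0) / (fact d * mult_const ^ d * W)"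
  have "norm x \<ge> \<kappa> / H ^ d" if "lat H x" and x: "x \<noteq> 0" and H: "H \<ge> 1" for H x
  proof -
    obtain y where y: "x = (\<Sum>i<d. of_int (y i) * w i)" "(\<Sum>i<d. real_of_int \<bar>y i\<bar>) \<le> H"
      using \<open>lat H x\<close> unfolding lat_def by auto
    define M where "M = Matrix.mat d d (\<lambda>(i, k). \<Sum>j<d. y j * c j i k)"
    define E where "E = mult_const * H"
    have E1: "E \<ge> 1" using mult_mono[of 1 mult_const 1 H] mult_const_ge_1 H by (simp add: E_def)
    have M: "M \<in> carrier_mat d d" by (simp add: M_def)
    have Mw: "x * w i = (\<Sum>k<d. of_int (M $$ (i, k)) * w k)" if "i < d" for i
    proof -
      have "x * w i = (\<Sum>j<d. of_int (y j) * (w j * w i))" by (simp add: y(1) sum_distrib_right mult.assoc)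
      also have "\<dots> = (\<Sum>j<d. \<Sum>k<d. of_int (y j * c j i k) * w k)"
        using that by (simp add: mult sum_distrib_left mult.assoc)
      also have "\<dots> = (\<Sum>k<d. of_int (M $$ (i, k)) * w k)"
        using that by (subst sum.swap) (simp add: M_def sum_distrib_right)
      finally show ?thesis .
    qed
    have ME: "real_of_int \<bar>M $$ (i, k)\<bar> \<le> E" if "i < d" "k < d" for i k
    proof -
      have c: "real_of_int \<bar>c j i k\<bar> \<le> mult_const" if "j < d" for j
        using sum_c_le[OF that \<open>i < d\<close>] member_le_sum[of k "{..<d}" "\<lambda>k. real_of_int \<bar>c j i k\<bar>"] \<open>k < d\<close>
        by simp
      have "real_of_int \<bar>M $$ (i, k)\<bar> = \<bar>\<Sum>j<d. real_of_int (y j) * real_of_int (c j i k)\<bar>" using that by (simp add: M_def)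
      also have "\<dots> \<le> (\<Sum>j<d. real_of_int \<bar>y j\<bar> * real_of_int \<bar>c j i k\<bar>)"
        by (rule order_trans[OF sum_abs]) (simp add: abs_mult)
      also have "\<dots> \<le> (\<Sum>j<d. real_of_int \<bar>y j\<bar> * mult_const)"
        using c by (intro sum_mono mult_left_mono) auto
      also have "\<dots> = mult_const * (\<Sum>j<d. real_of_int \<bar>y j\<bar>)" by (simp add: sum_distrib_left mult.commute)
      also have "\<dots> \<le> E" unfolding E_def using y(2) mult_const_ge_1 by (intro mult_left_mono) auto
      finally show ?thesis .
    qed
    have det: "det M \<noteq> 0"
    proof
      assume "det M = 0"
      then have "det (transpose_mat M) = 0" using det_transpose[OF M] by simp
      then obtain u where u: "u \<in> carrier_vec d" "u \<noteq> 0\<^sub>v d" "transpose_mat M *\<^sub>v u = 0\<^sub>v d"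
        using det_0_iff_vec_prod_zero[of "transpose_mat M" d] M by auto
      have uM: "(\<Sum>i<d. vec_index u i * M $$ (i, k)) = 0" if "k < d" for k
      proof -
        have "vec_index (transpose_mat M *\<^sub>v u) k = 0" using u(3) that by simp
        then show ?thesis using that M u(1)
          by (simp add: scalar_prod_def atLeast0LessThan mult.commute)
      qed
      have "x * (\<Sum>i<d. of_int (vec_index u i) * w i) = (\<Sum>i<d. of_int (vec_index u i) * (x * w i))"
        by (simp add: sum_distrib_left algebra_simps)
      also have "\<dots> = (\<Sum>i<d. \<Sum>k<d. of_int (vec_index u i * M $$ (i, k)) * w k)"
        by (simp add: Mw sum_distrib_left mult.assoc)
      also have "\<dots> = (\<Sum>k<d. of_int (\<Sum>i<d. vec_index u i * M $$ (i, k)) * w k)"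
        by (subst sum.swap) (simp add: sum_distrib_right)
      also have "\<dots> = 0" using uM by simp
      finally have "(\<Sum>i<d. of_int (vec_index u i) * w i) = 0" using x by simp
      then have "\<forall>i<d. vec_index u i = 0" using indep by blast
      then show False using u(1,2) by (auto simp: vec_eq_iff)
    qed
    define a where "a = (\<lambda>k. adj_mat M $$ (0, k))"
    have adj: "adj_mat M \<in> carrier_mat d d" "adj_mat M * M = det M \<cdot>\<^sub>m 1\<^sub>m d" using adj_mat[OF M] by auto
    have aM: "(\<Sum>k<d. a k * M $$ (k, i)) = (if i = 0 then det M else 0)" if "i < d" for i
    proof -
      have "(adj_mat M * M) $$ (0, i) = (if i = 0 then det M else 0)" using that False by (simp add: adj(2))
      then show ?thesis using that False adj(1) M
        by (simp add: scalar_prod_def atLeast0LessThan a_def)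
    qed
    have aE: "real_of_int \<bar>a k\<bar> \<le> fact d * E ^ d" if "k < d" for k
    proof -
      have "a k = cofactor M k 0" using that False M by (simp add: a_def adj_mat_def)
      then have "\<bar>a k\<bar> = \<bar>det (mat_delete M k 0)\<bar>" by (simp add: cofactor_def abs_mult power_abs)
      also have "real_of_int \<dots> \<le> fact (d - 1) * E ^ (d - 1)"
      proof (rule det_int_bound)
        show "mat_delete M k 0 \<in> carrier_mat (d - 1) (d - 1)" using M by (rule mat_delete_carrier)
        fix i j assume ij: "i < d - 1" "j < d - 1"
        show "real_of_int \<bar>mat_delete M k 0 $$ (i, j)\<bar> \<le> E"
          using ij M ME[of i "Suc j"] ME[of "Suc i" "Suc j"] by (simp add: mat_delete_def)
      qed
      also have "\<dots> \<le> fact d * E ^ d"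
        using E1 by (intro mult_mono fact_mono power_increasing) auto
      finally show ?thesis .
    qed
    have "of_int (det M) * w 0 = (\<Sum>i<d. if i = 0 then of_int (det M) * w i else 0)"
      using False by (simp add: sum.delta)
    also have "\<dots> = (\<Sum>i<d. of_int (\<Sum>k<d. a k * M $$ (k, i)) * w i)"
      using aM by (intro sum.cong) auto
    also have "\<dots> = (\<Sum>k<d. of_int (a k) * (x * w k))"
      by (simp add: Mw sum_distrib_left sum_distrib_right mult.assoc) (rule sum.swap)
    also have "\<dots> = x * (\<Sum>k<d. of_int (a k) * w k)" by (simp add: sum_distrib_left algebra_simps)
    finally have eq: "of_int (det M) * w 0 = x * (\<Sum>k<d. of_int (a k) * w k)" .
    have "norm (w 0) \<le> real_of_int \<bar>det M\<bar> * norm (w 0)"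
    proof -
      have "1 \<le> \<bar>det M\<bar>" using det by simp
      then have "1 \<le> real_of_int \<bar>det M\<bar>" by linarith
      then show ?thesis using mult_right_mono[of 1 "real_of_int \<bar>det M\<bar>" "norm (w 0)"] by simp
    qed
    also have "\<dots> = norm x * norm (\<Sum>k<d. of_int (a k) * w k)"
      using arg_cong[OF eq, of norm] by (simp add: norm_mult)
    also have "\<dots> \<le> norm x * (\<Sum>k<d. (fact d * E ^ d) * norm (w k))"
    proof (intro mult_left_mono order_trans[OF norm_sum] sum_mono)
      fix k assume "k \<in> {..<d}"
      then show "norm (of_int (a k) * w k) \<le> fact d * E ^ d * norm (w k)"
        using mult_right_mono[OF aE[of k], of "norm (w k)"] by (simp add: norm_mult)
    qed auto
    also have "\<dots> = norm x * (fact d * mult_const ^ d * W) * H ^ d"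
      by (simp add: W_def E_def sum_distrib_left power_mult_distrib algebra_simps)
    finally have "norm (w 0) \<le> norm x * (fact d * mult_const ^ d * W) * H ^ d" .
    moreover have "fact d * mult_const ^ d * W > 0" using W0 mult_const_ge_1 by simp
    moreover have "H ^ d > 0" using H by simp
    ultimately have "norm (w 0) / (fact d * mult_const ^ d * W * H ^ d) \<le> norm x"
      using pos_divide_le_eq[of "fact d * mult_const ^ d * W * H ^ d" "norm (w 0)" "norm x"]
      by (metis mult.assoc zero_less_mult_iff)
    then show ?thesis by (simp add: \<kappa>_def)
  qed
  moreover have "\<kappa> > 0" using w0 W0 mult_const_ge_1 by (simp add: \<kappa>_def zero_less_mult_iff)
  ultimately show ?thesis by blast
qed

end

section \<open>Entire functions with many zeros, and small integer solutions\<close>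

lemma divide_out_zeros:
  assumes "finite Z" "f holomorphic_on UNIV" "\<And>z. z \<in> Z \<Longrightarrow> f z = 0"
  shows "\<exists>g. g holomorphic_on UNIV \<and> (\<forall>z. f z = g z * (\<Prod>a\<in>Z. z - a))"
  using assms
proof (induction Z arbitrary: f rule: finite_induct)
  case empty then show ?case by auto
next
  case (insert a Z)
  define h where "h = (\<lambda>z. if z = a then deriv f a else (f z - f a) / (z - a))"
  have h: "h holomorphic_on UNIV"
    unfolding h_def using pole_lemma_open[OF insert.prems(1) open_UNIV, of a] by simp
  have fh: "f z = h z * (z - a)" for z using insert.prems(2)[of a] by (auto simp: h_def)
  have "h z = 0" if "z \<in> Z" for z
    using fh[of z] insert.prems(2)[of z] that insert.hyps(2) by auto
  from insert.IH[OF h this] obtain g where g: "g holomorphic_on UNIV" "\<forall>z. h z = g z * (\<Prod>a\<in>Z. z - a)"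
    by blast
  have "f z = g z * (\<Prod>a\<in>insert a Z. z - a)" for z
    using fh[of z] g(2) insert.hyps by (simp add: ac_simps)
  then show ?case using g(1) by blast
qed

text \<open>
  The quotient of \<open>f\<close> by the product of the \<open>z - a\<close> is entire. On the circle of radius \<open>5r\<close> each factor is
  at least \<open>4r\<close>, and at a point \<open>x\<close> with \<open>\<bar>x\<bar> \<le> r\<close> it is at most \<open>2r\<close>, so by the maximum modulus principle
  each zero gains a factor 2.
\<close>

lemma schwarz_many_zeros:
  assumes "finite Z" "f holomorphic_on UNIV" "\<And>z. z \<in> Z \<Longrightarrow> f z = 0"
    and r: "r > 0" and Z: "\<And>z. z \<in> Z \<Longrightarrow> norm z \<le> r"
    and B: "\<And>z. norm z = 5 * r \<Longrightarrow> norm (f z) \<le> B"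
    and x: "norm x \<le> r"
  shows "norm (f x) \<le> B / 2 ^ card Z"
proof -
  obtain g where g: "g holomorphic_on UNIV" "\<And>z. f z = g z * (\<Prod>a\<in>Z. z - a)"
    using divide_out_zeros[OF assms(1-3)] by blast
  have "norm (f (of_real (5 * r))) \<le> B" using r by (intro B) simp
  then have B0: "B \<ge> 0" using norm_ge_zero order_trans by blast
  have "norm (g x) \<le> B / (4 * r) ^ card Z"
  proof (rule maximum_modulus_frontier[of g "ball 0 (5 * r)"])
    show "g holomorphic_on interior (ball 0 (5 * r))" using g(1) holomorphic_on_subset by blast
    show "continuous_on (closure (ball 0 (5 * r))) g"
      using holomorphic_on_imp_continuous_on[OF g(1)] continuous_on_subset by blast
    show "bounded (ball (0::complex) (5 * r))" by simp
    show "x \<in> ball 0 (5 * r)" using x r by simp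
    fix z :: complex assume "z \<in> frontier (ball 0 (5 * r))"
    then have z: "norm z = 5 * r" using r by (simp add: frontier_ball)
    have "(4 * r) ^ card Z = (\<Prod>a\<in>Z. 4 * r)" by simp
    also have "\<dots> \<le> (\<Prod>a\<in>Z. norm (z - a))"
    proof (intro prod_mono conjI)
      fix a assume "a \<in> Z"
      then show "4 * r \<le> norm (z - a)" using Z[of a] norm_triangle_ineq2[of z a] z by linarith
    qed (use r in auto)
    finally have "norm (g z) * (4 * r) ^ card Z \<le> norm (g z) * (\<Prod>a\<in>Z. norm (z - a))"
      by (intro mult_left_mono) auto
    also have "\<dots> = norm (f z)" by (simp add: g(2) norm_mult prod_norm)
    also have "\<dots> \<le> B" using B z by simp
    finally show "norm (g z) \<le> B / (4 * r) ^ card Z" using r by (simp add: pos_le_divide_eq)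
  qed
  moreover have "(\<Prod>a\<in>Z. norm (x - a)) \<le> (2 * r) ^ card Z"
  proof -
    have "(\<Prod>a\<in>Z. norm (x - a)) \<le> (\<Prod>a\<in>Z. 2 * r)"
    proof (intro prod_mono conjI)
      fix a assume "a \<in> Z"
      then show "norm (x - a) \<le> 2 * r" using Z[of a] x norm_triangle_ineq4[of x a] by linarith
    qed auto
    then show ?thesis by simp
  qed
  ultimately have "norm (g x) * (\<Prod>a\<in>Z. norm (x - a)) \<le> B / (4 * r) ^ card Z * (2 * r) ^ card Z"
    using B0 r by (intro mult_mono) (auto simp: prod_nonneg)
  also have "\<dots> = B / 2 ^ card Z"
  proof -
    have "(4 * r) ^ card Z = 2 ^ card Z * (2 * r) ^ card Z" using power_mult_distrib[of 2 "2 * r"] by simp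
    then show ?thesis using r by simp
  qed
  finally show ?thesis by (simp add: g(2) norm_mult prod_norm)
qed

text \<open>
  Siegel's lemma by the pigeonhole principle. With \<open>Y = \<bar>U\<bar> A\<close>, the \<open>(2Y + 1)^\<bar>U\<bar>\<close> integer vectors in a
  box of side \<open>2Y\<close> have at most \<open>(4Y\<^sup>2 + 1)^\<bar>E\<bar>\<close> images, which is fewer because \<open>2\<bar>E\<bar> \<le> \<bar>U\<bar>\<close> and
  \<open>4Y\<^sup>2 + 1 < (2Y + 1)\<^sup>2\<close>. The difference of two vectors with the same image is a solution.
\<close>

lemma siegel:
  fixes a :: "'e \<Rightarrow> 'u \<Rightarrow> int" and A :: nat
  assumes U: "finite U" and E: "finite E" "U \<noteq> {}" and card: "2 * card E \<le> card U"
    and a: "\<And>e u. e \<in> E \<Longrightarrow> u \<in> U \<Longrightarrow> \<bar>a e u\<bar> \<le> int A" and A: "A \<ge> 1"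
  shows "\<exists>p :: 'u \<Rightarrow> int. (\<exists>u\<in>U. p u \<noteq> 0) \<and> (\<forall>u\<in>U. \<bar>p u\<bar> \<le> 2 * int (card U * A)) \<and>
     (\<forall>e\<in>E. (\<Sum>u\<in>U. a e u * p u) = 0)"
proof -
  define Y where "Y = card U * A"
  have Y: "Y \<ge> 1" using U E A by (simp add: Y_def card_gt_0_iff Suc_le_eq)
  define P where "P = (U \<rightarrow>\<^sub>E {0..2 * int Y})"
  define R where "R = (E \<rightarrow>\<^sub>E {- (2 * int Y * int Y)..2 * int Y * int Y})"
  define \<Phi> where "\<Phi> = (\<lambda>p. \<lambda>e\<in>E. \<Sum>u\<in>U. a e u * p u)"
  have sub: "\<Phi> ` P \<subseteq> R"
  proof
    fix y assume "y \<in> \<Phi> ` P"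
    then obtain p where p: "p \<in> P" "y = \<Phi> p" by auto
    have "\<bar>\<Sum>u\<in>U. a e u * p u\<bar> \<le> 2 * int Y * int Y" if e: "e \<in> E" for e
    proof -
      have "\<bar>\<Sum>u\<in>U. a e u * p u\<bar> \<le> (\<Sum>u\<in>U. \<bar>a e u * p u\<bar>)" by (rule sum_abs)
      also have "\<dots> \<le> (\<Sum>u\<in>U. int A * (2 * int Y))"
      proof (rule sum_mono)
        fix u assume u: "u \<in> U"
        then have "p u \<in> {0..2 * int Y}" using p(1) unfolding P_def by (rule PiE_mem[rotated])
        then have "\<bar>a e u\<bar> * \<bar>p u\<bar> \<le> int A * (2 * int Y)" by (intro mult_mono a e u) auto
        then show "\<bar>a e u * p u\<bar> \<le> int A * (2 * int Y)" by (simp add: abs_mult)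
      qed
      also have "\<dots> = 2 * int Y * int Y" by (simp add: Y_def)
      finally show ?thesis .
    qed
    then have "(\<Sum>u\<in>U. a e u * p u) \<in> {- (2 * int Y * int Y)..2 * int Y * int Y}" if "e \<in> E" for e
      using that by (metis abs_le_D1 abs_le_D2 atLeastAtMost_iff minus_le_iff)
    then show "y \<in> R" unfolding p(2) R_def \<Phi>_def by (rule restrict_PiE_iff[THEN iffD2, rule_format])
  qed
  have fR: "finite R" using E by (auto simp: R_def intro!: finite_PiE)
  have "card R = (4 * Y * Y + 1) ^ card E"
  proof -
    have "card {- (2 * int Y * int Y)..2 * int Y * int Y} = 4 * Y * Y + 1"
      by (simp add: nat_eq_iff)
    then show ?thesis using E by (simp add: R_def card_PiE)
  qed
  also have "\<dots> < card P"
  proof -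
    have "(4 * Y * Y + 1) ^ card E < ((2 * Y + 1) ^ 2) ^ card E \<or> card E = 0"
      using Y by (auto intro!: power_strict_mono simp: power2_eq_square algebra_simps)
    moreover have "((2 * Y + 1) ^ 2) ^ card E \<le> (2 * Y + 1) ^ card U"
      using card by (simp add: power_mult[symmetric] power_increasing)
    moreover have "card U > 0" using U E by (simp add: card_gt_0_iff)
    then have "1 < (2 * Y + 1) ^ card U" using Y by (intro one_less_power) auto
    moreover have "card P = (2 * Y + 1) ^ card U"
    proof -
      have "card {0..2 * int Y} = 2 * Y + 1" by (simp add: nat_eq_iff)
      then show ?thesis using U by (simp add: P_def card_PiE)
    qed
    ultimately show ?thesis by auto
  qed
  finally have "card R < card P" .
  then have "\<not> inj_on \<Phi> P" using card_inj_on_le[OF _ sub fR] by linarith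
  then obtain p q where pq: "p \<in> P" "q \<in> P" "p \<noteq> q" "\<Phi> p = \<Phi> q" by (auto simp: inj_on_def)
  show ?thesis
  proof (intro exI[of _ "\<lambda>u. p u - q u"] conjI ballI)
    show "\<exists>u\<in>U. p u - q u \<noteq> 0"
    proof (rule ccontr)
      assume "\<not> ?thesis"
      then have "p = q" using pq(1,2) unfolding P_def by (intro PiE_ext[of p U _ q]) auto
      then show False using pq(3) by auto
    qed
    fix u assume u: "u \<in> U"
    have "p u \<in> {0..2 * int Y}" "q u \<in> {0..2 * int Y}"
      using pq(1,2) u unfolding P_def by (auto dest: PiE_mem)
    then show "\<bar>p u - q u\<bar> \<le> 2 * int (card U * A)" by (auto simp: Y_def)
  next
    fix e assume e: "e \<in> E"
    have "\<Phi> p e = \<Phi> q e" using pq(4) by simp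
    then show "(\<Sum>u\<in>U. a e u * (p u - q u)) = 0"
      using e by (simp add: \<Phi>_def algebra_simps sum_subtractf)
  qed
qed

section \<open>The Gelfond-Schneider theorem\<close>

lemma poly_sum_monom_eq_0:
  fixes c :: "nat \<Rightarrow> complex"
  assumes inf: "infinite Z" and z: "\<And>z. z \<in> Z \<Longrightarrow> (\<Sum>i<n. c i * z ^ i) = 0" and "i < n"
  shows "c i = 0"
proof -
  define P where "P = (\<Sum>i<n. monom (c i) i)"
  have "poly P z = (\<Sum>i<n. c i * z ^ i)" for z by (simp add: P_def poly_sum poly_monom)
  then have "Z \<subseteq> {z. poly P z = 0}" using z by auto
  then have "P = 0" using inf poly_roots_finite[of P] finite_subset by blast
  moreover have "coeff P i = c i" using \<open>i < n\<close> by (simp add: P_def coeff_sum)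
  ultimately show ?thesis by simp
qed

text \<open>
  The functions \<open>z\<close> and \<open>exp(sz)\<close> are algebraically independent: shifting \<open>z\<close> by the periods of \<open>exp(sz)\<close>
  changes only the polynomial part, so the two variables can be separated.
\<close>

lemma exp_poly_eq_0:
  fixes p :: "nat \<Rightarrow> nat \<Rightarrow> complex"
  assumes s: "s \<noteq> 0" and F: "\<And>z. (\<Sum>i<m. \<Sum>j<n. p i j * (z ^ i * exp (of_nat j * s * z))) = 0"
    and ij: "i < m" "j < n"
  shows "p i j = 0"
proof -
  define \<tau> where "\<tau> = 2 * of_real pi * \<i> / s"
  have \<tau>: "\<tau> \<noteq> 0" using s by (simp add: \<tau>_def)
  have per: "exp (of_nat j * s * (z + of_nat k * \<tau>)) = exp (of_nat j * s * z)" for j k :: nat and z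
  proof -
    have "of_nat j * s * (z + of_nat k * \<tau>) = of_nat j * s * z + of_real (2 * of_nat (j * k) * pi) * \<i>"
      using s by (simp add: \<tau>_def field_simps)
    then show ?thesis using exp_integer_2pi[of "of_nat (j * k)"] by (simp only: exp_add Ints_of_nat mult_1_right)
  qed
  have 1: "(\<Sum>j<n. p i j * exp (of_nat j * s * z)) = 0" if "i < m" for i z
  proof (rule poly_sum_monom_eq_0[where Z = "range (\<lambda>k. z + of_nat k * \<tau>)" and n = m
        and c = "\<lambda>i. \<Sum>j<n. p i j * exp (of_nat j * s * z)"])
    have "inj (\<lambda>k. z + of_nat k * \<tau>)" using \<tau> by (auto simp: inj_on_def)
    then show "infinite (range (\<lambda>k. z + of_nat k * \<tau>))" using finite_imageD by blast
    fix u assume "u \<in> range (\<lambda>k. z + of_nat k * \<tau>)"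
    then obtain k where u: "u = z + of_nat k * \<tau>" by auto
    have "0 = (\<Sum>i<m. \<Sum>j<n. p i j * (u ^ i * exp (of_nat j * s * z)))"
      using F[of u] unfolding u per by simp
    also have "\<dots> = (\<Sum>i<m. u ^ i * (\<Sum>j<n. p i j * exp (of_nat j * s * z)))"
      unfolding sum_distrib_left by (simp only: mult.left_commute)
    also have "\<dots> = (\<Sum>i<m. (\<Sum>j<n. p i j * exp (of_nat j * s * z)) * u ^ i)"
      by (simp only: mult.commute)
    finally show "(\<Sum>i<m. (\<Sum>j<n. p i j * exp (of_nat j * s * z)) * u ^ i) = 0" by simp
  qed (use that in auto)
  show ?thesis
  proof (rule poly_sum_monom_eq_0[where Z = "- {0}" and n = n and c = "p i"])
    show "infinite (- {0::complex})"
      using infinite_UNIV_char_0[where 'a = complex] by (simp add: Compl_eq_Diff_UNIV)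
    fix y :: complex assume y: "y \<in> - {0}"
    have "exp (of_nat j * s * (Ln y / s)) = y ^ j" for j
    proof -
      have "of_nat j * s * (Ln y / s) = of_nat j * Ln y" using s by simp
      then show ?thesis using y by (simp add: exp_of_nat_mult)
    qed
    then show "(\<Sum>j<n. p i j * y ^ j) = 0" using 1[OF ij(1), of "Ln y / s"] by simp
  qed (use ij in auto)
qed

text \<open>
  The final comparison of sizes: with \<open>T \<le> \<surd>M\<close> the left side is \<open>exp(O(M \<surd>M log M))\<close>.
\<close>

lemma growth_bound:
  fixes c :: nat and K :: real
  assumes K: "K > 0" and c: "c > 0"
  shows "\<exists>M0>0. \<forall>M\<ge>M0. \<forall>T. T\<^sup>2 \<le> M \<longrightarrow> (K * real (M + 1)) ^ (c * M * T) < 2 ^ (M\<^sup>2)"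
proof -
  have "eventually (\<lambda>m::real. real c * sqrt m * ln (K * (m + 1)) < m * ln 2) at_top"
    using assms by real_asymp
  then have "eventually (\<lambda>M::nat. real c * sqrt (real M) * ln (K * (real M + 1)) < real M * ln 2) at_top"
    by (rule eventually_nat_real)
  moreover have "eventually (\<lambda>M::nat. K * (real M + 1) > 1) at_top"
    using assms by real_asymp
  ultimately have "eventually (\<lambda>M::nat. M > 0 \<and> real c * sqrt (real M) * ln (K * (real M + 1)) < real M * ln 2
      \<and> K * (real M + 1) > 1) at_top"
    using eventually_gt_at_top[of "0::nat"] by eventually_elim auto
  then obtain M0 where M0: "\<And>M. M \<ge> M0 \<Longrightarrow> M > 0 \<and>
      real c * sqrt (real M) * ln (K * (real M + 1)) < real M * ln 2 \<and> K * (real M + 1) > 1"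
    by (auto simp: eventually_at_top_linorder)
  have "(K * real (M + 1)) ^ (c * M * T) < 2 ^ (M\<^sup>2)" if "M \<ge> M0" "T\<^sup>2 \<le> M" for M T
  proof -
    define X where "X = K * (real M + 1)"
    have X: "X > 1" and M: "M > 0" and l: "real c * sqrt (real M) * ln X < real M * ln 2"
      using M0[OF that(1)] by (auto simp: X_def)
    have "real T \<le> sqrt (real M)" using that(2) by (intro real_le_rsqrt) (simp flip: of_nat_power)
    then have "real c * real T * ln X \<le> real c * sqrt (real M) * ln X"
      using X by (intro mult_right_mono mult_left_mono) auto
    then have "real c * real T * ln X < real M * ln 2" using l by linarith
    then have "real M * (real c * real T * ln X) < real M * (real M * ln 2)"
      using M by (intro mult_strict_left_mono) auto
    then have "ln (X ^ (c * M * T)) < ln (2 ^ (M\<^sup>2))"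
      using X by (simp add: ln_realpow power2_eq_square ac_simps)
    then have "X ^ (c * M * T) < 2 ^ (M\<^sup>2)" using X by (subst (asm) ln_less_cancel_iff) auto
    then show ?thesis by (simp add: X_def add.commute)
  qed
  then show ?thesis using M0 by (metis gr0I le_refl less_irrefl)
qed

text \<open>
  The situation to be refuted. The given algebraic numbers \<open>b1\<close>, \<open>b2\<close> are rescaled so that they lie in the
  order; \<open>q\<close> is a common denominator for their exponentials, and \<open>h\<close> bounds all sizes.
\<close>

locale schneider = int_order +
  fixes q :: int and h :: real and b1 b2 s :: complex
  assumes q: "q \<ge> 1" and h: "h \<ge> 1" and s: "s \<noteq> 0"
    and lat_q: "lat h (of_int q)" and lat_b1: "lat h b1" and lat_b2: "lat h b2"
    and lat_a1: "lat h (of_int q * exp (s * b1))" and lat_a2: "lat h (of_int q * exp (s * b2))"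
    and b_indep: "\<And>a b :: int. of_int a * b1 + of_int b * b2 = 0 \<Longrightarrow> a = 0 \<and> b = 0"
begin

definition pt :: "nat \<Rightarrow> nat \<Rightarrow> complex" where
  "pt a r = of_nat a * b1 + of_nat r * b2"

definition expoly :: "(nat \<Rightarrow> nat \<Rightarrow> int) \<Rightarrow> nat \<Rightarrow> nat \<Rightarrow> complex \<Rightarrow> complex" where
  "expoly p m n z = (\<Sum>i<m. \<Sum>j<n. of_int (p i j) * (z ^ i * exp (of_nat j * s * z)))"

text \<open>
  A bound for the size of the functions \<open>z\<^sup>i exp(jsz)\<close>, \<open>i < m\<close>, \<open>j < n\<close>, at the points \<open>pt a r\<close> with
  \<open>a, r < M\<close>, after multiplication by \<open>q^(1 + 2Mn)\<close>: the denominator of \<open>exp(s b1)^(aj) exp(s b2)^(rj)\<close>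
  divides \<open>q^(2Mn)\<close>, and one more factor \<open>q\<close> brings the value into the order.
\<close>

definition monomial_height :: "nat \<Rightarrow> nat \<Rightarrow> nat \<Rightarrow> real" where
  "monomial_height m n M = h * (2 * mult_const * h * real M) ^ m * (mult_const * h * q) ^ (2 * M * n)"

lemma d_pos: "d > 0"
proof (rule ccontr)
  assume "\<not> d > 0"
  then have "of_int q = (0::complex)" using lat_q by (auto simp only: lat_def)  (simp)
  then show False using q by simp
qed

lemma pt_inj: "pt a r = pt a' r' \<Longrightarrow> a = a' \<and> r = r'"
proof -
  assume "pt a r = pt a' r'"
  then have "of_int (int a - int a') * b1 + of_int (int r - int r') * b2 = 0"
    by (simp add: pt_def algebra_simps)
  from b_indep[OF this] show ?thesis by simp
qed

lemma norm_pt_le: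
  assumes "a \<le> M" "r \<le> M"
  shows "norm (pt a r) \<le> real M * (norm b1 + norm b2)"
proof -
  have "norm (pt a r) \<le> real a * norm b1 + real r * norm b2"
    unfolding pt_def by (rule order_trans[OF norm_triangle_ineq]) (simp add: norm_mult)
  also have "\<dots> \<le> real M * norm b1 + real M * norm b2"
    using assms by (intro add_mono mult_right_mono) auto
  finally show ?thesis by (simp add: algebra_simps)
qed

lemma monomial_height_ge_1: "M \<ge> 1 \<Longrightarrow> monomial_height m n M \<ge> 1"
proof -
  assume M: "M \<ge> 1"
  have ch: "mult_const * h \<ge> 1" using mult_mono[of 1 mult_const 1 h] mult_const_ge_1 h by simp
  have "2 * mult_const * h * real M \<ge> 1" using mult_mono[of 1 "2 * (mult_const * h)" 1 "real M"] ch M by (simp add: mult.assoc)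
  moreover have "mult_const * h * q \<ge> 1" using mult_mono[of 1 "mult_const * h" 1 "real_of_int q"] ch q by simp
  ultimately have "1 * 1 * 1 \<le> monomial_height m n M" unfolding monomial_height_def
    using h mult_const_ge_1 of_nat_0_le_iff[of M]
    by (intro mult_mono one_le_power mult_nonneg_nonneg zero_le_power) linarith+
  then show ?thesis by simp
qed

lemma lat_monomial:
  assumes "a < M" "r < M" "i < m" "j < n"
  shows "lat (monomial_height m n M)
    (of_int q ^ (1 + 2 * M * n) * (pt a r ^ i * exp (of_nat j * s * pt a r)))"
proof -
  have M: "M \<ge> 1" using assms by simp
  have ch: "mult_const * h \<ge> 1" using mult_mono[of 1 mult_const 1 h] mult_const_ge_1 h by simp
  have aj: "a * j + r * j \<le> 2 * M * n"
  proof -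
    have "a * j \<le> M * n" "r * j \<le> M * n" using assms by (intro mult_le_mono; simp)+
    then show ?thesis by simp
  qed
  have "lat (real a * h + real r * h) (pt a r)"
    unfolding pt_def using lat_add[OF lat_scale[OF lat_b1, of "int a"] lat_scale[OF lat_b2, of "int r"]] by simp
  then have "lat (2 * h * real M) (pt a r)"
  proof (rule lat_mono)
    have "real a * h + real r * h \<le> real M * h + real M * h"
      using assms h by (intro add_mono mult_right_mono) auto
    then show "real a * h + real r * h \<le> 2 * h * real M" by simp
  qed
  from lat_mult_power[OF lat_q this, of i]
  have "lat (h * (mult_const * (2 * h * real M)) ^ i) (of_int q * pt a r ^ i)" .
  from lat_mult_power[OF lat_mult_power[OF this lat_a1, of "a * j"] lat_a2, of "r * j"]
  have "lat (h * (mult_const * (2 * h * real M)) ^ i * (mult_const * h) ^ (a * j) * (mult_const * h) ^ (r * j))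
     (of_int q * pt a r ^ i * (of_int q * exp (s * b1)) ^ (a * j) * (of_int q * exp (s * b2)) ^ (r * j))" .
  from lat_scale[OF this, of "q ^ (2 * M * n - (a * j + r * j))"]
  have l: "lat (real_of_int \<bar>q ^ (2 * M * n - (a * j + r * j))\<bar> *
      (h * (mult_const * (2 * h * real M)) ^ i * (mult_const * h) ^ (a * j) * (mult_const * h) ^ (r * j)))
     (of_int (q ^ (2 * M * n - (a * j + r * j))) *
      (of_int q * pt a r ^ i * (of_int q * exp (s * b1)) ^ (a * j) * (of_int q * exp (s * b2)) ^ (r * j)))" .
  have e: "exp (of_nat j * s * pt a r) = exp (s * b1) ^ (a * j) * exp (s * b2) ^ (r * j)"
    by (simp add: pt_def exp_of_nat_mult[symmetric] exp_add[symmetric] algebra_simps)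
  have qp: "of_int q ^ (1 + 2 * M * n) =
      (of_int q :: complex) ^ (2 * M * n - (a * j + r * j)) * of_int q * of_int q ^ (a * j) * of_int q ^ (r * j)"
  proof -
    have "1 + 2 * M * n = (2 * M * n - (a * j + r * j)) + 1 + a * j + r * j" using aj by simp
    then show ?thesis by (metis power_add power_one_right)
  qed
  have val: "of_int (q ^ (2 * M * n - (a * j + r * j))) *
      (of_int q * pt a r ^ i * (of_int q * exp (s * b1)) ^ (a * j) * (of_int q * exp (s * b2)) ^ (r * j))
    = of_int q ^ (1 + 2 * M * n) * (pt a r ^ i * exp (of_nat j * s * pt a r))"
    unfolding e qp by (simp add: power_mult_distrib ac_simps)
  have "real_of_int \<bar>q ^ (2 * M * n - (a * j + r * j))\<bar> *
      (h * (mult_const * (2 * h * real M)) ^ i * (mult_const * h) ^ (a * j) * (mult_const * h) ^ (r * j))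
    = h * (2 * mult_const * h * real M) ^ i * (real_of_int q ^ (2 * M * n - (a * j + r * j)) * (mult_const * h) ^ (a * j + r * j))"
    using q by (simp add: power_add ac_simps)
  also have "\<dots> \<le> h * (2 * mult_const * h * real M) ^ m * (real_of_int q ^ (2 * M * n) * (mult_const * h) ^ (2 * M * n))"
  proof (intro mult_mono power_increasing)
    show "1 \<le> 2 * mult_const * h * real M"
      using mult_mono[of 1 "2 * (mult_const * h)" 1 "real M"] ch M by (simp add: mult.assoc)
  qed (use assms aj q h ch mult_const_ge_1 in auto)
  also have "\<dots> = monomial_height m n M" by (simp add: monomial_height_def power_mult_distrib ac_simps)
  finally show ?thesis using l unfolding val by (rule lat_mono[rotated])
qed

lemma expoly_scaled:
  "of_int q ^ (1 + 2 * M * n) * expoly p m n z =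
    (\<Sum>i<m. \<Sum>j<n. of_int (p i j) * (of_int q ^ (1 + 2 * M * n) * (z ^ i * exp (of_nat j * s * z))))"
  unfolding expoly_def by (simp add: sum_distrib_left ac_simps)

text \<open>
  Each of the \<open>N\<^sup>2\<close> vanishing conditions amounts to \<open>d\<close> linear equations over the integers, one for each
  coordinate in the order; Siegel's lemma solves them with \<open>mn \<ge> 2dN\<^sup>2\<close> unknowns.
\<close>

lemma auxiliary_function:
  assumes N: "N \<ge> 1" and mn: "2 * d * N * N \<le> m * n" and pos: "m \<ge> 1" "n \<ge> 1"
  shows "\<exists>p. (\<exists>i<m. \<exists>j<n. p i j \<noteq> 0) \<and>
    (\<forall>i<m. \<forall>j<n. real_of_int \<bar>p i j\<bar> \<le> 4 * real (m * n) * monomial_height m n N) \<and>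
    (\<forall>a<N. \<forall>r<N. expoly p m n (pt a r) = 0)"
proof -
  define V where "V = (\<lambda>a r i j. of_int q ^ (1 + 2 * N * n) * (pt a r ^ i * exp (of_nat j * s * pt a r)))"
  have "\<exists>y. V a r i j = (\<Sum>k<d. of_int (y k) * w k) \<and> (\<Sum>k<d. real_of_int \<bar>y k\<bar>) \<le> monomial_height m n N"
    if "a < N" "r < N" "i < m" "j < n" for a r i j
    using lat_monomial[OF that] unfolding V_def lat_def .
  then obtain y where y: "\<And>a r i j. a < N \<Longrightarrow> r < N \<Longrightarrow> i < m \<Longrightarrow> j < n \<Longrightarrow>
      V a r i j = (\<Sum>k<d. of_int (y a r i j k) * w k) \<and> (\<Sum>k<d. real_of_int \<bar>y a r i j k\<bar>) \<le> monomial_height m n N"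
    by metis
  define A where "A = nat \<lfloor>monomial_height m n N\<rfloor>"
  have mh: "monomial_height m n N \<ge> 1" using monomial_height_ge_1 N by blast
  have A1: "A \<ge> 1" using mh by (simp add: A_def le_nat_iff)
  have A2: "real A \<le> monomial_height m n N" using mh by (simp add: A_def)
  have yA: "\<bar>y a r i j k\<bar> \<le> int A" if "a < N" "r < N" "i < m" "j < n" "k < d" for a r i j k
  proof -
    have "real_of_int \<bar>y a r i j k\<bar> \<le> (\<Sum>k<d. real_of_int \<bar>y a r i j k\<bar>)"
      using that by (intro member_le_sum[of k "{..<d}" "\<lambda>k. real_of_int \<bar>y a r i j k\<bar>"]) auto
    also have "\<dots> \<le> monomial_height m n N" using y that by blast
    finally have "\<bar>y a r i j k\<bar> \<le> \<lfloor>monomial_height m n N\<rfloor>" by (simp add: le_floor_iff)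
    then show ?thesis using mh by (simp add: A_def)
  qed
  have "\<exists>p. (\<exists>u\<in>{..<m} \<times> {..<n}. p u \<noteq> 0) \<and>
      (\<forall>u\<in>{..<m} \<times> {..<n}. \<bar>p u\<bar> \<le> 2 * int (card ({..<m} \<times> {..<n}) * A)) \<and>
      (\<forall>e\<in>{..<N} \<times> {..<N} \<times> {..<d}. (\<Sum>u\<in>{..<m} \<times> {..<n}. (\<lambda>(a, r, k) (i, j). y a r i j k) e u * p u) = 0)"
  proof (rule siegel)
    show "{..<m} \<times> {..<n} \<noteq> {}" using pos by (auto simp: lessThan_empty_iff)
    show "2 * card ({..<N} \<times> {..<N} \<times> {..<d}) \<le> card ({..<m} \<times> {..<n})" using mn by (simp add: ac_simps)
    show "\<bar>(\<lambda>(a, r, k) (i, j). y a r i j k) e u\<bar> \<le> int A"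
      if "e \<in> {..<N} \<times> {..<N} \<times> {..<d}" "u \<in> {..<m} \<times> {..<n}" for e u
      using that yA by auto
    show "A \<ge> 1" by (rule A1)
  qed auto
  then obtain p where p: "\<exists>u\<in>{..<m} \<times> {..<n}. p u \<noteq> 0"
      "\<And>u. u \<in> {..<m} \<times> {..<n} \<Longrightarrow> \<bar>p u\<bar> \<le> 2 * int (card ({..<m} \<times> {..<n}) * A)"
      "\<And>e. e \<in> {..<N} \<times> {..<N} \<times> {..<d} \<Longrightarrow> (\<Sum>u\<in>{..<m} \<times> {..<n}. (\<lambda>(a, r, k) (i, j). y a r i j k) e u * p u) = 0"
    by blast
  show ?thesis
  proof (intro exI[of _ "\<lambda>i j. p (i, j)"] conjI allI impI)
    show "\<exists>i<m. \<exists>j<n. p (i, j) \<noteq> 0" using p(1) by auto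
    fix i j assume ij: "i < m" "j < n"
    have "\<bar>p (i, j)\<bar> \<le> 2 * int (m * n * A)" using p(2)[of "(i, j)"] ij by simp
    then have "real_of_int \<bar>p (i, j)\<bar> \<le> real_of_int (2 * int (m * n * A))" by (simp only: of_int_le_iff)
    also have "\<dots> = 2 * real (m * n) * real A" by simp
    also have "\<dots> \<le> 4 * real (m * n) * monomial_height m n N" using A2 mh by (intro mult_mono) auto
    finally show "real_of_int \<bar>p (i, j)\<bar> \<le> 4 * real (m * n) * monomial_height m n N" .
  next
    fix a r assume ac: "a < N" "r < N"
    have co: "(\<Sum>i<m. \<Sum>j<n. y a r i j k * p (i, j)) = 0" if "k < d" for k
      using p(3)[of "(a, r, k)"] ac that by (simp add: sum.cartesian_product split_def)
    have "of_int q ^ (1 + 2 * N * n) * expoly (\<lambda>i j. p (i, j)) m n (pt a r) =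
       (\<Sum>i<m. \<Sum>j<n. of_int (p (i, j)) * V a r i j)"
      unfolding expoly_scaled V_def ..
    also have "\<dots> = (\<Sum>i<m. \<Sum>j<n. \<Sum>k<d. of_int (y a r i j k * p (i, j)) * w k)"
      using y ac by (simp add: sum_distrib_left ac_simps)
    also have "\<dots> = (\<Sum>k<d. \<Sum>i<m. \<Sum>j<n. of_int (y a r i j k * p (i, j)) * w k)"
      by (rule sum_rotate3[symmetric])
    also have "\<dots> = (\<Sum>k<d. of_int (\<Sum>i<m. \<Sum>j<n. y a r i j k * p (i, j)) * w k)"
      by (simp add: sum_distrib_right)
    also have "\<dots> = 0" using co by simp
    finally show "expoly (\<lambda>i j. p (i, j)) m n (pt a r) = 0" using q by simp
  qed
qed

lemma norm_expoly_le:
  assumes p: "\<And>i j. i < m \<Longrightarrow> j < n \<Longrightarrow> real_of_int \<bar>p i j\<bar> \<le> P" and P: "P \<ge> 0"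
    and z: "norm z \<le> R"
  shows "norm (expoly p m n z) \<le> real (m * n) * P * (1 + R) ^ m * exp (norm s * R) ^ n"
proof -
  have R: "R \<ge> 0" using z norm_ge_zero order_trans by blast
  have "norm (expoly p m n z) \<le> (\<Sum>i<m. \<Sum>j<n. norm (of_int (p i j) * (z ^ i * exp (of_nat j * s * z))))"
    unfolding expoly_def by (rule order_trans[OF norm_sum]) (intro sum_mono norm_sum)
  also have "\<dots> \<le> (\<Sum>i<m. \<Sum>j<n. P * ((1 + R) ^ m * exp (norm s * R) ^ n))"
  proof (intro sum_mono)
    fix i j assume ij: "i \<in> {..<m}" "j \<in> {..<n}"
    have "norm z ^ i \<le> (1 + R) ^ i" using z by (intro power_mono) auto
    also have "\<dots> \<le> (1 + R) ^ m" using ij R by (intro power_increasing) auto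
    finally have 1: "norm (z ^ i) \<le> (1 + R) ^ m" by (simp add: norm_power)
    have "norm (exp (of_nat j * s * z)) \<le> exp (norm (of_nat j * s * z))" by (rule norm_exp)
    also have "\<dots> \<le> exp (real n * (norm s * R))"
      using ij z R by (auto simp: norm_mult mult.assoc intro!: mult_mono)
    also have "\<dots> = exp (norm s * R) ^ n" by (rule exp_of_nat_mult)
    finally have 2: "norm (exp (of_nat j * s * z)) \<le> exp (norm s * R) ^ n" .
    have "norm (of_int (p i j) :: complex) * (norm (z ^ i) * norm (exp (of_nat j * s * z))) \<le> P * ((1 + R) ^ m * exp (norm s * R) ^ n)"
      using p[of i j] ij P R by (intro mult_mono 1 2) auto
    then show "norm (of_int (p i j) * (z ^ i * exp (of_nat j * s * z))) \<le> P * ((1 + R) ^ m * exp (norm s * R) ^ n)"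
      by (simp only: norm_mult)
  qed
  also have "\<dots> = real (m * n) * P * (1 + R) ^ m * exp (norm s * R) ^ n" by simp
  finally show ?thesis .
qed

lemma expoly_holomorphic: "expoly p m n holomorphic_on UNIV"
  unfolding expoly_def by (intro holomorphic_intros)

text \<open>
  There are \<open>M\<^sup>2\<close> zeros in a disc whose radius is only linear in \<open>M\<close>. This surplus of zeros, which comes
  from the two independent numbers \<open>b1\<close> and \<open>b2\<close>, drives the proof.
\<close>

lemma expoly_upper:
  assumes p: "\<And>i j. i < m \<Longrightarrow> j < n \<Longrightarrow> real_of_int \<bar>p i j\<bar> \<le> P" and P: "P \<ge> 0"
    and zero: "\<And>a r. a < M \<Longrightarrow> r < M \<Longrightarrow> expoly p m n (pt a r) = 0"
    and R: "R = real (M + 1) * (norm b1 + norm b2)" and x: "norm x \<le> R"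
  shows "norm (expoly p m n x) * 2 ^ (M\<^sup>2) \<le> real (m * n) * P * (1 + 5 * R) ^ m * exp (norm s * (5 * R)) ^ n"
proof -
  define Z where "Z = (\<lambda>(a, r). pt a r) ` ({..<M} \<times> {..<M})"
  have "b1 \<noteq> 0" using b_indep[of 1 0] by auto
  then have R0: "R > 0" unfolding R by (intro mult_pos_pos add_pos_nonneg) auto
  have "inj_on (\<lambda>(a, r). pt a r) ({..<M} \<times> {..<M})" using pt_inj by (auto simp: inj_on_def)
  then have "card Z = M\<^sup>2" by (simp add: Z_def card_image power2_eq_square)
  moreover have "norm (expoly p m n x) \<le> (real (m * n) * P * (1 + 5 * R) ^ m * exp (norm s * (5 * R)) ^ n) / 2 ^ card Z"
  proof (rule schwarz_many_zeros[OF _ expoly_holomorphic _ R0 _ _ x])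
    show "finite Z" by (simp add: Z_def)
    show "expoly p m n z = 0" if "z \<in> Z" for z using that zero by (auto simp: Z_def)
    show "norm z \<le> R" if "z \<in> Z" for z
    proof -
      from that obtain a r where z: "a < M" "r < M" "z = pt a r" by (auto simp: Z_def)
      then show ?thesis using norm_pt_le[of a "M + 1" r] by (simp add: R)
    qed
    show "norm (expoly p m n z) \<le> real (m * n) * P * (1 + 5 * R) ^ m * exp (norm s * (5 * R)) ^ n"
      if "norm z = 5 * R" for z
      using that by (intro norm_expoly_le p P) auto
  qed
  ultimately show ?thesis by (simp add: pos_le_divide_eq)
qed

lemma expoly_lower:
  assumes p: "\<And>i j. i < m \<Longrightarrow> j < n \<Longrightarrow> real_of_int \<bar>p i j\<bar> \<le> P" and P: "P \<ge> 1"
    and mn: "m \<ge> 1" "n \<ge> 1" and M: "M \<ge> 1"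
    and \<kappa>: "\<And>H x. lat H x \<Longrightarrow> x \<noteq> 0 \<Longrightarrow> H \<ge> 1 \<Longrightarrow> norm x \<ge> \<kappa> / H ^ d"
    and ar: "a < M" "r < M" and nz: "expoly p m n (pt a r) \<noteq> 0"
  shows "\<kappa> / (real (m * n) * P * monomial_height m n M) ^ d
    \<le> real_of_int q ^ (1 + 2 * M * n) * norm (expoly p m n (pt a r))"
proof -
  define G where "G = of_int q ^ (1 + 2 * M * n) * expoly p m n (pt a r)"
  have "lat (\<Sum>i<m. \<Sum>j<n. real_of_int \<bar>p i j\<bar> * monomial_height m n M) G"
    unfolding G_def expoly_scaled by (intro lat_sum lat_scale lat_monomial ar) auto
  moreover have "(\<Sum>i<m. \<Sum>j<n. real_of_int \<bar>p i j\<bar> * monomial_height m n M) \<le> (\<Sum>i<m. \<Sum>j<n. P * monomial_height m n M)"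
    using monomial_height_ge_1[OF M, of m n] p by (intro sum_mono mult_right_mono) auto
  ultimately have l: "lat (real (m * n) * P * monomial_height m n M) G" by (auto intro: lat_mono)
  have "1 * 1 * 1 \<le> real (m * n) * P * monomial_height m n M"
  proof (intro mult_mono P monomial_height_ge_1 M)
    have "1 * 1 \<le> m * n" using mn by (intro mult_le_mono) auto
    then show "1 \<le> real (m * n)" by linarith
  qed (use P in auto)
  then have "\<kappa> / (real (m * n) * P * monomial_height m n M) ^ d \<le> norm G"
    using nz q by (intro \<kappa> l) (auto simp: G_def)
  also have "norm G = real_of_int q ^ (1 + 2 * M * n) * norm (expoly p m n (pt a r))"
    using q by (simp add: G_def norm_mult norm_power)
  finally show ?thesis .
qed

text \<open>
  The degrees are \<open>m = 2dT\<^sup>3\<close> in \<open>z\<close> and \<open>n = T\<close> in the exponential, and the initial zeros are the \<open>pt a r\<close>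
  with \<open>a, r < T\<^sup>2\<close>. For \<open>M \<ge> T\<^sup>2\<close> all sizes that occur are powers of \<open>X M = K(M + 1)\<close> with exponents
  of order \<open>MT \<le> M \<surd>M\<close> (up to constants depending on \<open>d\<close>), whereas the zeros contribute \<open>2\<close> to the power \<open>M\<^sup>2\<close>.
\<close>

lemma schneider_contradiction: False
proof -
  obtain \<kappa> where \<kappa>0: "\<kappa> > 0"
    and \<kappa>: "\<And>H x. lat H x \<Longrightarrow> x \<noteq> 0 \<Longrightarrow> H \<ge> 1 \<Longrightarrow> norm x \<ge> \<kappa> / H ^ d"
    using liouville by blast
  define \<beta> where "\<beta> = norm b1 + norm b2"
  have \<beta>: "\<beta> > 0" using b_indep[of 1 0] by (auto simp: \<beta>_def intro!: add_pos_nonneg)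
  \<comment> \<open>K dominates every constant of the estimates, so that they all become powers of \<open>X M\<close>.\<close>
  define K where "K = 2 * mult_const * h * q + 16 * (real d)\<^sup>2 + (1 + 5 * \<beta>) + exp (norm s * (5 * \<beta>)) + 1 / \<kappa>"
  have Ch: "mult_const * h \<ge> 1" using mult_mono[of 1 mult_const 1 h] mult_const_ge_1 h by simp
  have Chq: "mult_const * h \<le> mult_const * h * q" "q \<le> mult_const * h * q"
    using mult_left_mono[of 1 q "mult_const * h"] mult_right_mono[of 1 "mult_const * h" q] Ch q by auto
  have hCh: "h \<le> mult_const * h" using mult_right_mono[of 1 mult_const h] mult_const_ge_1 h by simp
  have nn: "0 \<le> 16 * (real d)\<^sup>2" "0 < exp (norm s * (5 * \<beta>))" "0 < 1 / \<kappa>" "0 < 1 + 5 * \<beta>"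
    using \<kappa>0 \<beta> by auto
  have K: "1 \<le> K" "h \<le> K" "2 * mult_const * h \<le> K" "mult_const * h * q \<le> K" "q \<le> K"
      "16 * (real d)\<^sup>2 \<le> K" "1 + 5 * \<beta> \<le> K" "exp (norm s * (5 * \<beta>)) \<le> K" "1 / \<kappa> \<le> K"
    using nn \<beta> Ch Chq hCh q unfolding K_def by linarith+
  \<comment> \<open>The constant 175 = 25 * 7 comes from the fact eC below.\<close>
  define C where "C = 175 * d\<^sup>2"
  have "C > 0" using d_pos by (simp add: C_def)
  then obtain M0 where M0: "M0 > 0" "\<And>M T. M \<ge> M0 \<Longrightarrow> T\<^sup>2 \<le> M \<Longrightarrow> (K * real (M + 1)) ^ (C * M * T) < 2 ^ (M\<^sup>2)"
    using growth_bound[of K C] K(1) by auto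
  define T where "T = M0"
  define n where "n = T"
  define m where "m = 2 * d * T ^ 3"
  have T: "T \<ge> 1" using M0(1) by (simp add: T_def)
  have mn1: "m \<ge> 1" "n \<ge> 1" using T d_pos by (simp_all add: m_def n_def Suc_le_eq)
  define P where "P = 4 * real (m * n) * monomial_height m n (T\<^sup>2)"
  have T2: "T\<^sup>2 \<ge> 1" "T\<^sup>2 \<ge> M0" using T by (simp_all add: T_def power2_eq_square)
  have "2 * d * T\<^sup>2 * T\<^sup>2 \<le> m * n" by (simp add: m_def n_def power2_eq_square power3_eq_cube)
  from auxiliary_function[OF T2(1) this mn1] obtain p where
    p_nz: "\<exists>i<m. \<exists>j<n. p i j \<noteq> 0" and p: "\<And>i j. i < m \<Longrightarrow> j < n \<Longrightarrow> real_of_int \<bar>p i j\<bar> \<le> P"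
    and p_zero: "\<And>a r. a < T\<^sup>2 \<Longrightarrow> r < T\<^sup>2 \<Longrightarrow> expoly p m n (pt a r) = 0"
    unfolding P_def by blast
  have mn: "real (m * n) \<ge> 1"
  proof -
    have "1 * 1 \<le> m * n" using mn1 by (intro mult_le_mono) auto
    then show ?thesis by linarith
  qed
  have P1: "P \<ge> 1"
  proof -
    have "1 * 1 \<le> 4 * real (m * n) * monomial_height m n (T\<^sup>2)"
      using mn by (intro mult_mono monomial_height_ge_1 T2) auto
    then show ?thesis by (simp add: P_def)
  qed
  define X where "X = (\<lambda>M. K * real (M + 1))"
  define e where "e = (\<lambda>M. 1 + m + 2 * (M + 1) * n)"
  have X1: "X M \<ge> 1" and XK: "X M \<ge> K" and XM: "X M \<ge> real M + 1" for M
  proof -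
    show "X M \<ge> K" using mult_left_mono[of 1 "real (M + 1)" K] K(1) by (simp add: X_def)
    then show "X M \<ge> 1" using K(1) by simp
    have "1 * real (M + 1) \<le> K * real (M + 1)" using K(1) by (intro mult_right_mono) auto
    then show "X M \<ge> real M + 1" by (simp only: X_def mult_1 of_nat_add of_nat_1)
  qed
  have powX: "X M ^ i \<le> X M ^ j" if "i \<le> j" for i j M using that X1 by (rule power_increasing)
  \<comment> \<open>The exponent \<open>e M\<close> covers the factors of the monomial height, the powers of \<open>q\<close>, and the growth on the disc.\<close>
  have height: "monomial_height m n M' \<le> X M ^ e M" if "M' \<le> M + 1" for M M'
  proof -
    have "2 * mult_const * h * real M' \<le> X M"
      unfolding X_def using that K Ch mult_const_ge_1 h by (intro mult_mono) auto
    moreover have "h \<le> X M" "mult_const * h * q \<le> X M" using XK[of M] K by linarith+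
    ultimately have "monomial_height m n M' \<le> X M ^ 1 * X M ^ m * X M ^ (2 * M' * n)"
      unfolding monomial_height_def power_one_right using X1[of M] Ch h q mult_const_ge_1
      by (intro mult_mono power_mono mult_nonneg_nonneg zero_le_power) auto
    also have "\<dots> = X M ^ (1 + m + 2 * M' * n)" by (simp only: power_add)
    also have "\<dots> \<le> X M ^ e M" unfolding e_def using that by (intro powX add_mono mult_le_mono) auto
    finally show ?thesis .
  qed
  have mnP: "real (m * n) * P \<le> X M ^ (9 + e M)" if M: "M \<ge> T\<^sup>2" for M
  proof -
    have "real T \<le> X M"
    proof -
      have "T \<le> M" using M T by (metis le_trans power2_nat_le_imp_le order_refl)
      then show ?thesis using XM[of M] by linarith
    qed
    then have "16 * (real d)\<^sup>2 * real T ^ 8 \<le> X M ^ 1 * X M ^ 8"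
      using K(6) XK[of M] X1[of M] unfolding power_one_right by (intro mult_mono power_mono) auto
    moreover have "real (m * n) * (4 * real (m * n)) = 16 * (real d)\<^sup>2 * real T ^ 8"
      by (simp add: m_def n_def power2_eq_square power3_eq_cube eval_nat_numeral)
    moreover have "X M ^ 1 * X M ^ 8 = X M ^ 9" by (simp only: power_add[symmetric]) simp
    ultimately have "real (m * n) * (4 * real (m * n)) \<le> X M ^ 9" by linarith
    moreover have "monomial_height m n (T\<^sup>2) \<le> X M ^ e M" using M by (intro height) auto
    ultimately have "real (m * n) * (4 * real (m * n)) * monomial_height m n (T\<^sup>2) \<le> X M ^ 9 * X M ^ e M"
      using X1[of M] monomial_height_ge_1[OF T2(1), of m n] by (intro mult_mono) auto
    then show ?thesis by (simp add: P_def power_add mult.assoc)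
  qed
  have eC: "10 + 9 * d + 2 * e M * d + 4 * e M \<le> C * M * T" if M: "M \<ge> T\<^sup>2" for M
  proof -
    have M1: "M \<ge> 1" using M T2 by linarith
    have dMT: "1 \<le> d * M * T" using d_pos M1 T by (simp add: Suc_le_eq)
    have "T ^ 3 = T\<^sup>2 * T" by (simp add: power3_eq_cube power2_eq_square)
    also have "\<dots> \<le> M * T" using M by (intro mult_le_mono) auto
    finally have "m \<le> 2 * (d * M * T)" by (simp add: m_def mult.assoc)
    moreover have "2 * (M + 1) * n \<le> 4 * (d * M * T)"
    proof -
      have "2 * (M + 1) \<le> 4 * M" using M1 by simp
      also have "\<dots> \<le> 4 * (d * M)" using d_pos by simp
      finally have "2 * (M + 1) \<le> 4 * (d * M)" .
      then show ?thesis using mult_le_mono[of "2 * (M + 1)" "4 * (d * M)" T T] by (simp add: n_def mult.assoc)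
    qed
    ultimately have e: "e M \<le> 7 * (d * M * T)" using dMT unfolding e_def by linarith
    have e1: "1 \<le> e M" by (simp add: e_def)
    have d1: "1 \<le> d" using d_pos by simp
    have "1 \<le> e M * d" using mult_le_mono[OF e1 d1] by simp
    moreover have "d \<le> e M * d" using mult_le_mono[OF e1 order_refl[of d]] by simp
    moreover have "e M \<le> e M * d" using mult_le_mono[OF order_refl[of "e M"] d1] by simp
    ultimately have "10 + 9 * d + 2 * e M * d + 4 * e M \<le> 25 * (e M * d)" by linarith
    also have "\<dots> \<le> 25 * (7 * (d * M * T) * d)" using e by (intro mult_le_mono) auto
    also have "\<dots> = C * M * T" by (simp add: C_def power2_eq_square)
    finally show ?thesis .
  qed
  have upper: "norm (expoly p m n x) * 2 ^ (M\<^sup>2) \<le> X M ^ (9 + 3 * e M)"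
    if M: "M \<ge> T\<^sup>2" and zero: "\<And>a r. a < M \<Longrightarrow> r < M \<Longrightarrow> expoly p m n (pt a r) = 0"
      and x: "norm x \<le> real (M + 1) * \<beta>" for M x
  proof -
    define R where "R = real (M + 1) * \<beta>"
    have R0: "R \<ge> 0" using \<beta> by (simp add: R_def)
    have 1: "(1 + 5 * R) ^ m \<le> X M ^ e M"
    proof -
      have "1 + 5 * R \<le> real (M + 1) * (1 + 5 * \<beta>)" by (simp add: R_def algebra_simps)
      also have "\<dots> \<le> X M" using mult_left_mono[OF K(7), of "real (M + 1)"] by (simp add: X_def mult.commute)
      finally have "(1 + 5 * R) ^ m \<le> X M ^ m" using R0 by (intro power_mono) auto
      also have "\<dots> \<le> X M ^ e M" by (intro powX) (simp add: e_def)
      finally show ?thesis .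
    qed
    have 2: "exp (norm s * (5 * R)) ^ n \<le> X M ^ e M"
    proof -
      have "norm s * (5 * R) = real (M + 1) * (norm s * (5 * \<beta>))" by (simp add: R_def)
      then have "exp (norm s * (5 * R)) ^ n = exp (norm s * (5 * \<beta>)) ^ ((M + 1) * n)"
        by (simp only: exp_of_nat_mult power_mult)
      also have "\<dots> \<le> X M ^ ((M + 1) * n)" using K(8) XK[of M] by (intro power_mono) auto
      also have "\<dots> \<le> X M ^ e M" by (intro powX) (simp add: e_def)
      finally show ?thesis .
    qed
    have "norm (expoly p m n x) * 2 ^ (M\<^sup>2) \<le> real (m * n) * P * (1 + 5 * R) ^ m * exp (norm s * (5 * R)) ^ n"
      using x P1 by (intro expoly_upper p zero) (auto simp: R_def \<beta>_def)
    also have "\<dots> \<le> X M ^ (9 + e M) * X M ^ e M * X M ^ e M"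
      using X1[of M] R0 P1 by (intro mult_mono mnP M 1 2 mult_nonneg_nonneg) auto
    also have "\<dots> = X M ^ (9 + 3 * e M)"
      unfolding power_add[symmetric] by (rule arg_cong[where f = "\<lambda>k. X M ^ k"]) simp
    finally show ?thesis .
  qed
  \<comment> \<open>Extrapolation: a nonzero value at a new point violates the comparison of the two bounds.\<close>
  have zero: "\<forall>a<M. \<forall>r<M. expoly p m n (pt a r) = 0" if "M \<ge> T\<^sup>2" for M
    using that
  proof (induction M rule: dec_induct)
    case base then show ?case using p_zero by blast
  next
    case (step M)
    show ?case
    proof (intro allI impI, rule ccontr)
      fix a r assume ar: "a < Suc M" "r < Suc M" and nz: "expoly p m n (pt a r) \<noteq> 0"
      define f where "f = norm (expoly p m n (pt a r))"
      have M: "M \<ge> T\<^sup>2" using step by simp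
      have up: "f * 2 ^ (M\<^sup>2) \<le> X M ^ (9 + 3 * e M)"
        unfolding f_def using step.IH norm_pt_le[of a "M + 1" r] ar by (intro upper M) (auto simp: \<beta>_def)
      have low: "\<kappa> / (real (m * n) * P * monomial_height m n (M + 1)) ^ d \<le> real_of_int q ^ (1 + 2 * (M + 1) * n) * f"
        unfolding f_def using ar nz P1 mn1 by (intro expoly_lower p \<kappa>) auto
      have "0 < real (m * n) * P * monomial_height m n (M + 1)"
        using mn P1 monomial_height_ge_1[of "M + 1" m n] by (intro mult_pos_pos) auto
      then have "\<kappa> \<le> real_of_int q ^ (1 + 2 * (M + 1) * n) * f * (real (m * n) * P * monomial_height m n (M + 1)) ^ d"
        using low by (simp add: pos_divide_le_eq)
      also have "\<dots> \<le> X M ^ e M * f * (X M ^ (9 + e M) * X M ^ e M) ^ d"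
      proof (intro mult_mono power_mono mnP M height)
        have "real_of_int q ^ (1 + 2 * (M + 1) * n) \<le> X M ^ (1 + 2 * (M + 1) * n)"
          using q K(5) XK[of M] by (intro power_mono) auto
        also have "\<dots> \<le> X M ^ e M" by (intro powX) (simp add: e_def)
        finally show "real_of_int q ^ (1 + 2 * (M + 1) * n) \<le> X M ^ e M" .
      qed (use X1[of M] mn P1 monomial_height_ge_1[of "M + 1" m n] q in \<open>auto simp: f_def\<close>)
      also have "\<dots> = f * X M ^ (e M + (9 + 2 * e M) * d)"
      proof -
        have "X M ^ (9 + e M) * X M ^ e M = X M ^ (9 + 2 * e M)"
          unfolding power_add[symmetric] by (rule arg_cong[where f = "\<lambda>k. X M ^ k"]) simp
        then show ?thesis by (simp add: power_add[of _ "e M"] power_mult)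
      qed
      finally have "1 \<le> (1 / \<kappa>) * (f * X M ^ (e M + (9 + 2 * e M) * d))"
        using \<kappa>0 by (simp add: pos_le_divide_eq)
      also have "\<dots> \<le> X M ^ 1 * (f * X M ^ (e M + (9 + 2 * e M) * d))"
        using K(9) XK[of M] X1[of M] unfolding power_one_right by (intro mult_right_mono) (auto simp: f_def)
      finally have "2 ^ (M\<^sup>2) * 1 \<le> 2 ^ (M\<^sup>2) * (X M ^ 1 * (f * X M ^ (e M + (9 + 2 * e M) * d)))"
        by (intro mult_left_mono) auto
      also have "\<dots> = (f * 2 ^ (M\<^sup>2)) * X M ^ (1 + (e M + (9 + 2 * e M) * d))" by (simp add: power_add)
      also have "\<dots> \<le> X M ^ (9 + 3 * e M) * X M ^ (1 + (e M + (9 + 2 * e M) * d))"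
        using X1[of M] by (intro mult_right_mono up) auto
      also have "\<dots> = X M ^ (10 + 9 * d + 2 * e M * d + 4 * e M)"
        unfolding power_add[symmetric] by (rule arg_cong[where f = "\<lambda>k. X M ^ k"]) (simp add: algebra_simps)
      also have "\<dots> \<le> X M ^ (C * M * T)" by (intro powX eC M)
      also have "\<dots> < 2 ^ (M\<^sup>2)" unfolding X_def using M T2 by (intro M0) auto
      finally show False by simp
    qed
  qed
  \<comment> \<open>With zeros at all \<open>pt a r\<close>, the upper bound at a fixed \<open>x\<close> tends to 0 as \<open>M\<close> grows.\<close>
  have "expoly p m n x = 0" for x
  proof (rule ccontr)
    assume nz: "expoly p m n x \<noteq> 0"
    define f where "f = norm (expoly p m n x)"
    have f: "f > 0" using nz by (simp add: f_def)
    define M where "M = T\<^sup>2 + nat \<lceil>norm x / \<beta>\<rceil> + nat \<lceil>1 / f\<rceil>"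
    have M: "M \<ge> T\<^sup>2" by (simp add: M_def)
    have "norm x / \<beta> \<le> real (M + 1)" unfolding M_def by linarith
    then have x: "norm x \<le> real (M + 1) * \<beta>" using \<beta> by (simp add: pos_divide_le_eq)
    have "1 / f \<le> real M + 1" unfolding M_def by linarith
    then have "1 / f \<le> X M" using XM[of M] by linarith
    then have "1 \<le> X M * f" using f by (simp add: pos_divide_le_eq)
    then have "2 ^ (M\<^sup>2) * 1 \<le> 2 ^ (M\<^sup>2) * (X M * f)" by (intro mult_left_mono) auto
    also have "\<dots> = X M * (f * 2 ^ (M\<^sup>2))" by simp
    also have "\<dots> \<le> X M * X M ^ (9 + 3 * e M)"
      unfolding f_def using zero[OF M] X1[of M] x by (intro mult_left_mono upper M) auto
    also have "\<dots> = X M ^ (10 + 3 * e M)" by (simp flip: power_Suc)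
    also have "\<dots> \<le> X M ^ (10 + 9 * d + 2 * e M * d + 4 * e M)" by (intro powX) simp
    also have "\<dots> \<le> X M ^ (C * M * T)" by (intro powX eC M)
    also have "\<dots> < 2 ^ (M\<^sup>2)" unfolding X_def using M T2 by (intro M0) auto
    finally show False by simp
  qed
  then have "of_int (p i j) = (0::complex)" if "i < m" "j < n" for i j
    using exp_poly_eq_0[OF s, where m = m and n = n and p = "\<lambda>i j. of_int (p i j)"] that unfolding expoly_def by blast
  then show False using p_nz by auto
qed

end

text \<open>
  Replacing \<open>b\<^sub>1, b\<^sub>2, s\<close> by \<open>q b\<^sub>1, q b\<^sub>2, s/q\<close> for a common denominator \<open>q\<close> does not change the two
  exponentials and moves the numbers into an order.
\<close>

theorem gelfond_schneider:
  fixes b1 b2 s :: complex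
  assumes alg: "algebraic b1" "algebraic b2" "algebraic (exp (s * b1))" "algebraic (exp (s * b2))"
    and s: "s \<noteq> 0"
    and lin_indep: "\<And>a b :: int. of_int a * b1 + of_int b * b2 = 0 \<Longrightarrow> a = 0 \<and> b = 0"
  shows False
proof -
  define X where "X = {1, b1, b2, exp (s * b1), exp (s * b2)}"
  have "finite X" "\<And>x. x \<in> X \<Longrightarrow> algebraic x" using alg by (auto simp: X_def)
  from int_order_exists[OF this] obtain d w c where ord: "int_order d w c"
    and den: "\<forall>x\<in>X. \<exists>q>0::int. \<exists>y. of_int q * x = (\<Sum>i<d. of_int (y i) * w i)"
    by blast
  interpret int_order d w c by (rule ord)
  have "\<forall>x\<in>X. \<exists>q>0::int. \<exists>H. lat H (of_int q * x)"
    using den unfolding lat_def by blast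
  then obtain Q :: "complex \<Rightarrow> int" where Q: "\<And>x. x \<in> X \<Longrightarrow> Q x > 0 \<and> (\<exists>H. lat H (of_int (Q x) * x))" by metis
  define q where "q = (\<Prod>x\<in>X. Q x)"
  have q0: "q > 0" unfolding q_def using Q by (intro prod_pos) auto
  have "\<exists>H. lat H (of_int q * x)" if "x \<in> X" for x
  proof -
    have "q = (\<Prod>x\<in>X - {x}. Q x) * Q x" unfolding q_def using \<open>finite X\<close> that by (simp add: prod.remove)
    then have "of_int q * x = of_int (\<Prod>x\<in>X - {x}. Q x) * (of_int (Q x) * x)" by (simp add: mult.assoc)
    then show ?thesis using Q[OF that] lat_scale by metis
  qed
  then obtain H where H: "\<And>x. x \<in> X \<Longrightarrow> lat (H x) (of_int q * x)" by metis
  define h where "h = 1 + (\<Sum>x\<in>X. H x)"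
  have nn: "H x \<ge> 0" if "x \<in> X" for x using lat_nonneg[OF H[OF that]] .
  then have h1: "h \<ge> 1" by (simp add: h_def sum_nonneg)
  have L: "lat h (of_int q * x)" if "x \<in> X" for x
    using member_le_sum[of x X H] that \<open>finite X\<close> nn by (intro lat_mono[OF H[OF that]]) (auto simp: h_def)
  interpret schneider d w c q h "of_int q * b1" "of_int q * b2" "s / of_int q"
  proof
    show "1 \<le> q" using q0 by simp
    show "1 \<le> h" by (rule h1)
    show "s / of_int q \<noteq> 0" using s q0 by simp
    show "lat h (of_int q)" using L[of 1] by (simp add: X_def)
    show "lat h (of_int q * b1)" "lat h (of_int q * b2)" using L by (simp_all add: X_def)
    have "s / of_int q * (of_int q * b) = s * b" for b using q0 by simp
    then show "lat h (of_int q * exp (s / of_int q * (of_int q * b1)))"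
      "lat h (of_int q * exp (s / of_int q * (of_int q * b2)))"
      using L by (simp_all add: X_def)
    fix a b :: int
    assume "of_int a * (of_int q * b1) + of_int b * (of_int q * b2) = 0"
    then have "of_int q * (of_int a * b1 + of_int b * b2) = 0" by (simp add: algebra_simps)
    then have "of_int a * b1 + of_int b * b2 = 0" using q0 by simp
    then show "a = 0 \<and> b = 0" by (rule lin_indep)
  qed
  show False by (rule schneider_contradiction)
qed

section \<open>Walks from a vertex and its eigenvalue support\<close>

text \<open>
  Applying a rational linear functional to an equation with rational coefficients on one side replaces
  complex data by rational data. This is used in place of Galois conjugation.
\<close>

lemma rational_functional:
  assumes "x \<noteq> (0::complex)"
  obtains \<phi> :: "complex \<Rightarrow> rat"
  where "\<phi> x = 1" "\<And>y z. \<phi> (y + z) = \<phi> y + \<phi> z" "\<And>q y. \<phi> (of_rat q * y) = q * \<phi> y"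
proof -
  define B where "B = rat_vs.extend_basis {x}"
  have ind: "rat_vs.independent {x}" using assms by (subst rat_vs.dependent_single)
  have B: "rat_vs.independent B" "x \<in> B" "rat_vs.span B = UNIV"
    using rat_vs.independent_extend_basis[OF ind] rat_vs.extend_basis_superset[OF ind]
      rat_vs.span_extend_basis[OF ind] by (auto simp: B_def)
  define \<phi> where "\<phi> = (\<lambda>v. rat_vs.representation B v x)"
  show thesis
  proof (rule that[of \<phi>])
    show "\<phi> x = 1" using rat_vs.representation_basis[OF B(1,2)] by (simp add: \<phi>_def)
    show "\<phi> (y + z) = \<phi> y + \<phi> z" for y z
      using rat_vs.representation_add[OF B(1), of z y] B(3) by (simp add: \<phi>_def)
    show "\<phi> (of_rat q * y) = q * \<phi> y" for q y
      using rat_vs.representation_scale[OF B(1), of y q] B(3) by (simp add: \<phi>_def)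
  qed
qed

text \<open>
  A prime in the denominator of \<open>c\<close> would occur to arbitrarily high powers in the denominators of the \<open>c\<^sup>j\<close>.
\<close>

lemma rat_int_if_powers_bounded_denominator:
  fixes c :: rat and D :: int
  assumes D: "D \<noteq> 0" and p: "\<And>j. of_int D * c ^ j \<in> \<int>"
  shows "c \<in> \<int>"
proof -
  obtain u v where uv: "quotient_of c = (u, v)" by (metis surj_pair)
  have c: "c = of_int u / of_int v" and v: "v > 0" and cop: "coprime u v"
    using uv quotient_of_div quotient_of_denom_pos quotient_of_coprime by blast+
  have dv: "v ^ j dvd D" for j
  proof -
    obtain k where "of_int D * c ^ j = of_int k" using p[of j] by (auto elim: Ints_cases)
    then have "(of_int (D * u ^ j) :: rat) = of_int (k * v ^ j)"
      using v by (simp add: c power_divide field_simps)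
    then have "D * u ^ j = k * v ^ j" by (simp only: of_int_eq_iff)
    then have "v ^ j dvd D * u ^ j" by simp
    moreover have "coprime (v ^ j) (u ^ j)" using cop by (simp add: coprime_commute)
    ultimately show ?thesis by (simp add: coprime_dvd_mult_left_iff)
  qed
  have "v = 1"
  proof (rule ccontr)
    assume "v \<noteq> 1"
    then have v2: "2 \<le> v" using v by simp
    have "2 ^ nat \<bar>D\<bar> \<le> v ^ nat \<bar>D\<bar>" using v2 by (intro power_mono) auto
    also have "\<dots> \<le> \<bar>D\<bar>" using dv[of "nat \<bar>D\<bar>"] D by (intro zdvd_imp_le) auto
    finally have "int (2 ^ nat \<bar>D\<bar>) \<le> int (nat \<bar>D\<bar>)" by simp
    then have "2 ^ nat \<bar>D\<bar> \<le> nat \<bar>D\<bar>" by (simp only: of_nat_le_iff)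
    then show False using less_exp[of "nat \<bar>D\<bar>"] by (meson leD)
  qed
  then show ?thesis by (simp add: c)
qed

text \<open>
  A finite connected graph with vertex set \<open>V\<close>, neighbourhoods \<open>N b\<close> and a distinguished vertex \<open>a\<close>.
  Connectedness is stated as the induction principle that is used: a set of vertices that contains \<open>a\<close> and
  is closed under taking neighbours is everything.
\<close>

locale rooted_graph =
  fixes V :: "'a set" and N :: "'a \<Rightarrow> 'a set" and a :: 'a
  assumes fin: "finite V" and N_sub: "\<And>b. b \<in> V \<Longrightarrow> N b \<subseteq> V"
    and N_sym: "\<And>b c. b \<in> V \<Longrightarrow> c \<in> V \<Longrightarrow> c \<in> N b \<longleftrightarrow> b \<in> N c"
    and root: "a \<in> V"
    and conn: "\<And>S. a \<in> S \<Longrightarrow> S \<subseteq> V \<Longrightarrow> (\<And>b. b \<in> S \<Longrightarrow> N b \<subseteq> S) \<Longrightarrow> S = V"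
begin

primrec walks :: "nat \<Rightarrow> 'a \<Rightarrow> nat" where
  "walks 0 b = (if b = a then 1 else 0)"
| "walks (Suc m) b = (\<Sum>c\<in>N b. walks m c)"

text \<open>
  In terms of the adjacency operator \<open>A\<close>, \<open>walks m\<close> is the vector \<open>A\<^sup>m e\<^sub>a\<close> and \<open>krylov p\<close> is the vector
  \<open>p(A) e\<^sub>a\<close>.
\<close>

definition krylov :: "complex poly \<Rightarrow> 'a \<Rightarrow> complex" where
  "krylov p b = (\<Sum>i\<le>degree p. coeff p i * of_nat (walks i b))"

definition annihilates :: "complex poly \<Rightarrow> bool" where
  "annihilates p \<longleftrightarrow> (\<forall>b\<in>V. krylov p b = 0)"

definition eigen :: "complex \<Rightarrow> ('a \<Rightarrow> complex) \<Rightarrow> bool" where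
  "eigen \<theta> v \<longleftrightarrow> (\<forall>b\<in>V. (\<Sum>c\<in>N b. v c) = \<theta> * v b)"

lemma finN: "b \<in> V \<Longrightarrow> finite (N b)"
  using N_sub fin finite_subset by blast

text \<open>The adjacency operator is symmetric.\<close>

lemma adjoint:
  fixes f g :: "'a \<Rightarrow> complex"
  shows "(\<Sum>b\<in>V. f b * (\<Sum>c\<in>N b. g c)) = (\<Sum>c\<in>V. (\<Sum>b\<in>N c. f b) * g c)"
proof -
  have N: "N b = {c \<in> V. c \<in> N b}" if "b \<in> V" for b using N_sub[OF that] by auto
  have "(\<Sum>b\<in>V. f b * (\<Sum>c\<in>N b. g c)) = (\<Sum>b\<in>V. \<Sum>c\<in>V. if c \<in> N b then f b * g c else 0)"
  proof (intro sum.cong refl)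
    fix b assume b: "b \<in> V"
    have "f b * (\<Sum>c\<in>N b. g c) = (\<Sum>c\<in>{c \<in> V. c \<in> N b}. f b * g c)"
      by (subst N[OF b]) (rule sum_distrib_left)
    also have "\<dots> = (\<Sum>c\<in>V. if c \<in> N b then f b * g c else 0)" by (rule sum.inter_filter[OF fin])
    finally show "f b * (\<Sum>c\<in>N b. g c) = \<dots>" .
  qed
  also have "\<dots> = (\<Sum>c\<in>V. \<Sum>b\<in>V. if c \<in> N b then f b * g c else 0)" by (rule sum.swap)
  also have "\<dots> = (\<Sum>c\<in>V. (\<Sum>b\<in>N c. f b) * g c)"
  proof (intro sum.cong refl)
    fix c assume c: "c \<in> V"
    have "(\<Sum>b\<in>N c. f b) * g c = (\<Sum>b\<in>{b \<in> V. b \<in> N c}. f b * g c)"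
      by (subst N[OF c]) (rule sum_distrib_right)
    also have "\<dots> = (\<Sum>b\<in>V. if b \<in> N c then f b * g c else 0)" by (rule sum.inter_filter[OF fin])
    also have "\<dots> = (\<Sum>b\<in>V. if c \<in> N b then f b * g c else 0)" using N_sym c by (intro sum.cong) auto
    finally show "(\<Sum>b\<in>V. if c \<in> N b then f b * g c else 0) = (\<Sum>b\<in>N c. f b) * g c" by simp
  qed
  finally show ?thesis .
qed

lemma krylov_eq: "degree p \<le> n \<Longrightarrow> krylov p b = (\<Sum>i\<le>n. coeff p i * of_nat (walks i b))"
  unfolding krylov_def by (intro sum.mono_neutral_left) (auto simp: coeff_eq_0)

lemma krylov_add: "krylov (p + q) b = krylov p b + krylov q b"
proof -
  define n where "n = max (degree p) (degree q)"
  have "degree (p + q) \<le> n" "degree p \<le> n" "degree q \<le> n"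
    by (auto simp: n_def degree_add_le_max)
  then show ?thesis by (simp add: krylov_eq[of _ n] algebra_simps sum.distrib)
qed

lemma krylov_smult: "krylov (smult x p) b = x * krylov p b"
proof -
  have "degree (smult x p) \<le> degree p" by (rule degree_smult_le)
  then show ?thesis by (simp add: krylov_eq[of _ "degree p"] sum_distrib_left mult.assoc)
qed

lemma krylov_diff: "krylov (p - q) b = krylov p b - krylov q b"
  using krylov_add[of p "smult (-1) q" b] krylov_smult[of "-1" q b] by simp

lemma krylov_shift: "(\<Sum>c\<in>N b. krylov p c) = krylov (pCons 0 p) b"
proof -
  have "krylov (pCons 0 p) b = (\<Sum>i\<le>Suc (degree p). coeff (pCons 0 p) i * of_nat (walks i b))"
    by (intro krylov_eq degree_pCons_le)
  also have "\<dots> = (\<Sum>i\<le>degree p. coeff p i * of_nat (walks (Suc i) b))"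
    by (subst sum.atMost_Suc_shift) simp
  also have "\<dots> = (\<Sum>i\<le>degree p. \<Sum>c\<in>N b. coeff p i * of_nat (walks i c))"
    by (simp add: sum_distrib_left)
  also have "\<dots> = (\<Sum>c\<in>N b. krylov p c)" unfolding krylov_def by (rule sum.swap)
  finally show ?thesis by simp
qed

lemma krylov_linear_factor: "(\<Sum>c\<in>N b. krylov q c) = \<theta> * krylov q b + krylov ([:-\<theta>, 1:] * q) b"
proof -
  have "[:-\<theta>, 1:] * q = smult (-\<theta>) q + pCons 0 q" by simp
  then show ?thesis by (simp only: krylov_shift krylov_add krylov_smult) simp
qed

text \<open>
  \<open>\<langle>v, A\<^sup>m e\<^sub>a\<rangle> = \<langle>A\<^sup>m v, e\<^sub>a\<rangle>\<close>, without complex conjugation.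
\<close>

lemma eigen_walks:
  assumes "eigen \<theta> v"
  shows "(\<Sum>b\<in>V. v b * of_nat (walks m b)) = \<theta> ^ m * v a"
proof (induction m)
  case 0
  have "(\<Sum>b\<in>V. v b * of_nat (walks 0 b)) = (\<Sum>b\<in>V. if b = a then v b else 0)"
    by (intro sum.cong) auto
  then show ?case using fin root by simp
next
  case (Suc m)
  have "(\<Sum>b\<in>V. v b * of_nat (walks (Suc m) b)) = (\<Sum>b\<in>V. v b * (\<Sum>c\<in>N b. of_nat (walks m c)))" by simp
  also have "\<dots> = (\<Sum>c\<in>V. (\<Sum>b\<in>N c. v b) * of_nat (walks m c))" by (rule adjoint)
  also have "\<dots> = \<theta> * (\<Sum>c\<in>V. v c * of_nat (walks m c))"
    using assms by (simp add: eigen_def sum_distrib_left mult.assoc)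
  finally show ?case using Suc by simp
qed

lemma eigen_krylov:
  assumes "eigen \<theta> v"
  shows "(\<Sum>b\<in>V. v b * krylov p b) = poly p \<theta> * v a"
proof -
  have "(\<Sum>b\<in>V. v b * krylov p b) = (\<Sum>b\<in>V. \<Sum>i\<le>degree p. coeff p i * (v b * of_nat (walks i b)))"
    unfolding krylov_def sum_distrib_left by (simp only: mult.left_commute)
  also have "\<dots> = (\<Sum>i\<le>degree p. coeff p i * (\<Sum>b\<in>V. v b * of_nat (walks i b)))"
    unfolding sum_distrib_left by (rule sum.swap)
  also have "\<dots> = poly p \<theta> * v a"
    by (simp add: eigen_walks[OF assms] poly_altdef sum_distrib_right mult.assoc)
  finally show ?thesis .
qed

text \<open>
  A linear relation between the \<open>2\<bar>V\<bar>\<close> integer vectors \<open>A\<^sup>i e\<^sub>a\<close> is a homogeneous system with \<open>\<bar>V\<bar>\<close>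
  equations, so Siegel's lemma provides one.
\<close>

lemma annihilator_exists: "\<exists>p. p \<noteq> 0 \<and> annihilates p"
proof -
  define n where "n = 2 * card V"
  define A where "A = 1 + (\<Sum>i<n. \<Sum>b\<in>V. walks i b)"
  have n: "n > 0" using fin root by (auto simp: n_def card_gt_0_iff)
  have A: "walks i b \<le> A" if "i < n" "b \<in> V" for i b
  proof -
    have "walks i b \<le> (\<Sum>b\<in>V. walks i b)" using that fin by (intro member_le_sum) auto
    also have "\<dots> \<le> (\<Sum>i<n. \<Sum>b\<in>V. walks i b)"
      using that by (intro member_le_sum[of i "{..<n}" "\<lambda>i. \<Sum>b\<in>V. walks i b"]) auto
    finally show ?thesis by (simp add: A_def)
  qed
  have "\<exists>p. (\<exists>i\<in>{..<n}. p i \<noteq> 0) \<and> (\<forall>i\<in>{..<n}. \<bar>p i\<bar> \<le> 2 * int (card {..<n} * A)) \<and>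
      (\<forall>b\<in>V. (\<Sum>i\<in>{..<n}. int (walks i b) * p i) = 0)"
  proof (rule siegel)
    show "{..<n} \<noteq> {}" using n by auto
    show "1 \<le> A" by (simp add: A_def)
    show "\<bar>int (walks i b)\<bar> \<le> int A" if "b \<in> V" "i \<in> {..<n}" for b i using A that by auto
  qed (use fin in \<open>auto simp: n_def\<close>)
  then obtain p where p: "\<exists>i<n. p i \<noteq> 0" "\<And>b. b \<in> V \<Longrightarrow> (\<Sum>i<n. int (walks i b) * p i) = 0" by auto
  define P :: "complex poly" where "P = (\<Sum>i<n. monom (of_int (p i)) i)"
  have co: "coeff P i = (if i < n then of_int (p i) else 0)" for i by (simp add: P_def coeff_sum)
  have "degree P \<le> n - 1" by (rule degree_le) (auto simp: co)
  then have "krylov P b = (\<Sum>i\<le>n - 1. coeff P i * of_nat (walks i b))" for b by (rule krylov_eq)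
  moreover have "{..n - 1} = {..<n}" using n by auto
  ultimately have "krylov P b = of_int (\<Sum>i<n. int (walks i b) * p i)" for b
    by (simp add: co mult.commute)
  then have "annihilates P" using p(2) by (simp add: annihilates_def del: of_int_sum of_int_mult)
  moreover have "P \<noteq> 0" using p(1) co by (metis coeff_0 of_int_eq_0_iff)
  ultimately show ?thesis by blast
qed

definition minimal :: "complex poly \<Rightarrow> bool" where
  "minimal p \<longleftrightarrow> lead_coeff p = 1 \<and> annihilates p \<and> (\<forall>q. q \<noteq> 0 \<longrightarrow> annihilates q \<longrightarrow> degree p \<le> degree q)"

lemma minimal_exists: "\<exists>p. minimal p"
proof -
  obtain p where p: "p \<noteq> 0 \<and> annihilates p" and least: "\<And>q. q \<noteq> 0 \<and> annihilates q \<Longrightarrow> degree p \<le> degree q"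
    using annihilator_exists ex_has_least_nat[of "\<lambda>p. p \<noteq> 0 \<and> annihilates p" _ degree] by metis
  define p' where "p' = smult (inverse (lead_coeff p)) p"
  have "degree p' = degree p" "lead_coeff p' = 1" using p by (simp_all add: p'_def)
  moreover have "annihilates p'" using p by (simp add: p'_def annihilates_def krylov_smult)
  ultimately have "minimal p'" using least by (auto simp: minimal_def)
  then show ?thesis by blast
qed

text \<open>
  A rational linear functional that fixes 1, applied to the coefficients, gives another monic annihilating
  polynomial of the same degree, since the walk counts are integers. By minimality the two agree.
\<close>

lemma minimal_rational:
  assumes "minimal p"
  shows "coeff p i \<in> \<rat>"
proof -
  obtain \<phi> :: "complex \<Rightarrow> rat" where \<phi>: "\<phi> 1 = 1" "\<And>y z. \<phi> (y + z) = \<phi> y + \<phi> z"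
      "\<And>q y. \<phi> (of_rat q * y) = q * \<phi> y"
    using rational_functional[of 1] by auto
  have \<phi>0: "\<phi> 0 = 0" using \<phi>(3)[of 0 0] by simp
  have \<phi>sum: "\<phi> (sum f I) = (\<Sum>i\<in>I. \<phi> (f i))" for f and I :: "nat set"
    by (induction I rule: infinite_finite_induct) (auto simp: \<phi>0 \<phi>)
  have \<phi>nat: "\<phi> (y * of_nat k) = \<phi> y * of_nat k" for y k
    using \<phi>(3)[of "of_nat k" y] by (simp add: mult.commute)
  define p' :: "complex poly" where "p' = map_poly (\<lambda>x. of_rat (\<phi> x)) p"
  have co: "coeff p' i = of_rat (\<phi> (coeff p i))" for i by (simp add: p'_def coeff_map_poly \<phi>0)
  have deg: "degree p' \<le> degree p" by (rule degree_le) (simp add: co coeff_eq_0 \<phi>0)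
  have "krylov p' b = of_rat (\<phi> (krylov p b))" for b
    unfolding krylov_eq[OF deg] krylov_def[of p] by (simp add: \<phi>sum \<phi>nat co of_rat_sum of_rat_mult)
  then have "annihilates p'" using assms by (simp add: minimal_def annihilates_def \<phi>0)
  then have ann: "annihilates (p - p')" using assms by (simp add: minimal_def annihilates_def krylov_diff)
  have top: "coeff (p - p') (degree p) = 0" using assms by (simp add: co minimal_def \<phi>(1))
  have "p - p' = 0"
  proof (rule ccontr)
    assume nz: "p - p' \<noteq> 0"
    then have "degree p \<le> degree (p - p')" using ann assms by (simp add: minimal_def)
    moreover have "degree (p - p') \<le> degree p" using deg by (intro degree_diff_le) auto
    ultimately have "lead_coeff (p - p') = 0" using top by simp
    then show False using nz by (simp only: leading_coeff_0_iff)
  qed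
  then have "p = p'" by simp
  then have "coeff p i = of_rat (\<phi> (coeff p i))" using co by metis
  then show ?thesis by (metis Rats_of_rat)
qed

text \<open>
  Write \<open>p = (x - \<theta>) q\<close>. By minimality \<open>v = q(A) e\<^sub>a\<close> is nonzero, and it is an eigenvector for \<open>\<theta>\<close>, so
  \<open>\<theta>\<close> is real by symmetry. Then \<open>\<langle>v, v\<rangle> = \<langle>v, q(A) e\<^sub>a\<rangle> = q(\<theta>) cnj(v\<^sub>a)\<close> shows at once that \<open>v\<^sub>a \<noteq> 0\<close> and that
  \<open>q(\<theta>) \<noteq> 0\<close>, that is, the root is simple. The coefficients of \<open>q\<close> are algebraic, and so are the entries
  of \<open>v\<close>.
\<close>

lemma minimal_root:
  assumes p: "minimal p" and root0: "poly p \<theta> = 0"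
  shows "\<theta> \<in> \<real>" "poly (pderiv p) \<theta> \<noteq> 0" "\<exists>v. eigen \<theta> v \<and> v a \<noteq> 0 \<and> (\<forall>b\<in>V. algebraic (v b))"
proof -
  obtain q where q: "p = [:-\<theta>, 1:] * q" using root0 by (auto simp: poly_eq_0_iff_dvd elim: dvdE)
  have p0: "p \<noteq> 0" using p by (auto simp: minimal_def)
  then have q0: "q \<noteq> 0" using q by auto
  have "degree p = Suc (degree q)" unfolding q using q0 by (subst degree_mult_eq) auto
  then have "\<not> annihilates q" using p q0 by (auto simp: minimal_def)
  then obtain b0 where b0: "b0 \<in> V" "krylov q b0 \<noteq> 0" by (auto simp: annihilates_def)
  define v where "v = krylov q"
  have ev: "eigen \<theta> v"
    unfolding eigen_def v_def
  proof
    fix b assume "b \<in> V"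
    then have "krylov p b = 0" using p by (simp add: minimal_def annihilates_def)
    then show "(\<Sum>c\<in>N b. krylov q c) = \<theta> * krylov q b" using krylov_linear_factor[of q b \<theta>] q by simp
  qed
  define S where "S = (\<Sum>b\<in>V. cnj (v b) * v b)"
  have S: "S \<noteq> 0"
  proof -
    have "S = of_real (\<Sum>b\<in>V. (norm (v b))\<^sup>2)"
      unfolding of_real_sum complex_norm_square S_def by (simp only: mult.commute)
    moreover have "(\<Sum>b\<in>V. (norm (v b))\<^sup>2) > 0"
      using b0 fin by (intro sum_pos2[of V b0]) (auto simp: v_def)
    ultimately show ?thesis by (metis less_irrefl of_real_eq_0_iff)
  qed
  have "\<theta> * S = (\<Sum>b\<in>V. cnj (v b) * (\<Sum>c\<in>N b. v c))"
    using ev by (simp add: S_def eigen_def sum_distrib_left mult.left_commute)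
  also have "\<dots> = (\<Sum>c\<in>V. (\<Sum>b\<in>N c. cnj (v b)) * v c)" by (rule adjoint)
  also have "\<dots> = (\<Sum>c\<in>V. cnj (\<Sum>b\<in>N c. v b) * v c)" by simp
  also have "\<dots> = cnj \<theta> * S"
    using ev by (simp add: S_def eigen_def sum_distrib_left mult.assoc)
  finally have real: "cnj \<theta> = \<theta>" using S by simp
  then show "\<theta> \<in> \<real>" by (simp add: Reals_cnj_iff)
  have ev': "eigen \<theta> (\<lambda>b. cnj (v b))"
    unfolding eigen_def
  proof
    fix b assume "b \<in> V"
    then have "cnj (\<Sum>c\<in>N b. v c) = cnj (\<theta> * v b)" using ev by (simp add: eigen_def)
    then show "(\<Sum>c\<in>N b. cnj (v c)) = \<theta> * cnj (v b)" by (simp add: real)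
  qed
  have "S = poly q \<theta> * cnj (v a)" using eigen_krylov[OF ev', of q] by (simp add: S_def v_def)
  then have qa: "poly q \<theta> \<noteq> 0" "v a \<noteq> 0" using S by auto
  show "poly (pderiv p) \<theta> \<noteq> 0" unfolding q by (subst pderiv_mult) (simp add: pderiv_pCons qa(1))
  have alg\<theta>: "algebraic \<theta>" using minimal_rational[OF p] p0 root0 by (intro algebraicI'[of p]) auto
  have algp: "algebraic (coeff p i)" for i using minimal_rational[OF p] by (rule rat_imp_algebraic)
  \<comment> \<open>Synthetic division, read from the leading coefficient downwards.\<close>
  have co: "coeff q i = coeff p (Suc i) + \<theta> * coeff q (Suc i)" for i by (simp add: q)
  have "algebraic (coeff q i)" if "i + k = Suc (degree q)" for i k
    using that
  proof (induction k arbitrary: i)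
    case 0 then show ?case by (simp add: coeff_eq_0)
  next
    case (Suc k)
    then have "algebraic (coeff q (Suc i))" by simp
    then show ?case by (subst co) (intro algebraic_add algebraic_mult algp alg\<theta>)
  qed
  then have algq: "algebraic (coeff q i)" if "i \<le> degree q" for i
    using that by (metis le_SucI le_add_diff_inverse)
  have "algebraic (v b)" for b
    unfolding v_def krylov_def by (intro algebraic_sum algebraic_mult algq algebraic_of_nat) auto
  then show "\<exists>v. eigen \<theta> v \<and> v a \<noteq> 0 \<and> (\<forall>b\<in>V. algebraic (v b))" using ev qa by blast
qed

end

section \<open>Bounding the order of the graph\<close>

lemma coprime_power_eq_dvd:
  fixes x y :: int
  assumes "x * w ^ s = y * u ^ s" "coprime u w"
  shows "u ^ s dvd x"
proof -
  have "u ^ s dvd x * w ^ s" using assms(1) by simp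
  moreover have "coprime (u ^ s) (w ^ s)" using assms(2) by simp
  ultimately show ?thesis by (simp add: coprime_dvd_mult_left_iff)
qed

text \<open>
  If \<open>x/y = u/w\<close> in lowest terms, then \<open>x = u\<eta>\<close> and \<open>y = w\<eta>\<close> for a real \<open>\<eta>\<close>, and \<open>\<eta>\<^sup>s\<close> is a nonzero
  integer by coprimality. So \<open>\<bar>\<eta>\<bar> \<ge> 1\<close>, and \<open>x - y\<close> is a nonzero integer multiple of \<open>\<eta>\<close>.
\<close>

lemma gap_of_commensurable_radicals:
  fixes x y :: real and m n :: int
  assumes s: "s > 0" and x: "x ^ s = of_int m" and y: "y ^ s = of_int n"
    and ne: "x \<noteq> y" and ratio: "x \<noteq> 0 \<Longrightarrow> y \<noteq> 0 \<Longrightarrow> x / y \<in> \<rat>"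
  shows "\<bar>x - y\<bar> \<ge> 1"
proof -
  have big: "\<bar>z\<bar> \<ge> 1" if "z ^ s = of_int k" "z \<noteq> 0" for z :: real and k
  proof (rule ccontr)
    assume "\<not> \<bar>z\<bar> \<ge> 1"
    then have "\<bar>z\<bar> ^ s < 1" using s by (intro power_less_one_iff[THEN iffD2]) auto
    then have "\<bar>real_of_int k\<bar> < 1" using that(1) by (simp flip: power_abs)
    then have "k = 0" by linarith
    then show False using that s by simp
  qed
  show ?thesis
  proof (cases "x = 0 \<or> y = 0")
    case True
    then show ?thesis using big[OF x] big[OF y] ne by auto
  next
    case False
    then have "x / y \<in> \<rat>" using ratio by blast
    then obtain u w :: int where w: "w > 0" "coprime u w" and uw: "x / y = of_int u / of_int w"
      by (rule Rats_cases') blast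
    have u: "u \<noteq> 0" using uw False w by auto
    define \<eta> where "\<eta> = y / of_int w"
    have ye: "y = of_int w * \<eta>" using w by (simp add: \<eta>_def)
    have xe: "x = of_int u * \<eta>" using uw False w by (simp add: \<eta>_def field_simps)
    have "of_int (m * w ^ s) = (of_int (n * u ^ s) :: real)"
      by (simp add: x[symmetric] y[symmetric] xe ye power_mult_distrib)
    then have "m * w ^ s = n * u ^ s" by (simp only: of_int_eq_iff)
    then obtain k where k: "m = u ^ s * k" using coprime_power_eq_dvd w(2) by (metis dvdE)
    have "\<eta> ^ s = of_int k" using x u by (simp add: xe k power_mult_distrib)
    moreover have "\<eta> \<noteq> 0" using ye False by auto
    ultimately have "\<bar>\<eta>\<bar> \<ge> 1" by (rule big)
    moreover have "u \<noteq> w" using ne xe ye by auto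
    then have "1 \<le> \<bar>real_of_int (u - w)\<bar>" by linarith
    ultimately have "1 * 1 \<le> \<bar>real_of_int (u - w)\<bar> * \<bar>\<eta>\<bar>" by (intro mult_mono) auto
    then show ?thesis by (simp add: xe ye abs_mult[symmetric] algebra_simps)
  qed
qed

lemma card_separated_le:
  fixes X :: "real set"
  assumes "\<And>x. x \<in> X \<Longrightarrow> \<bar>x\<bar> \<le> real k" and "\<And>x y. x \<in> X \<Longrightarrow> y \<in> X \<Longrightarrow> x \<noteq> y \<Longrightarrow> \<bar>x - y\<bar> \<ge> 1"
  shows "card X \<le> 2 * k + 1"
proof -
  have "inj_on floor X"
  proof (rule inj_onI, rule ccontr)
    fix x y assume "x \<in> X" "y \<in> X" "\<lfloor>x\<rfloor> = \<lfloor>y\<rfloor>" "x \<noteq> y"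
    then show False using assms(2)[of x y] by linarith
  qed
  moreover have "floor ` X \<subseteq> {- int k..int k}"
  proof
    fix z assume "z \<in> floor ` X"
    then obtain x where "x \<in> X" "z = \<lfloor>x\<rfloor>" by auto
    then show "z \<in> {- int k..int k}" using assms(1)[of x] by (simp add: le_floor_iff) linarith
  qed
  ultimately have "card X \<le> card {- int k..int k}" by (intro card_inj_on_le) auto
  then show ?thesis by simp
qed

context rooted_graph
begin

text \<open>
  Evaluate the eigenvalue equation at a vertex where \<open>v\<close> has maximal modulus.
\<close>

lemma eigenvalue_bound:
  assumes ev: "eigen \<theta> v" and nz: "v a \<noteq> 0" and k: "\<And>b. b \<in> V \<Longrightarrow> card (N b) \<le> k"
  shows "norm \<theta> \<le> real k"
proof -
  define B where "B = Max ((\<lambda>b. norm (v b)) ` V)"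
  have "B \<in> (\<lambda>b. norm (v b)) ` V" unfolding B_def using fin root by (intro Max_in) auto
  then obtain b where b: "b \<in> V" "B = norm (v b)" by auto
  have le: "norm (v c) \<le> norm (v b)" if "c \<in> V" for c
    unfolding b(2)[symmetric] B_def using fin that by (intro Max_ge) auto
  have "norm \<theta> * norm (v b) = norm (\<Sum>c\<in>N b. v c)" using ev b by (simp add: eigen_def norm_mult)
  also have "\<dots> \<le> (\<Sum>c\<in>N b. norm (v b))"
    using le N_sub[OF b(1)] by (intro order_trans[OF norm_sum] sum_mono) auto
  also have "\<dots> \<le> real k * norm (v b)" using k[OF b(1)] by (simp add: mult_right_mono)
  finally show ?thesis using le[OF root] nz by (auto simp: mult_le_cancel_right)
qed

text \<open>
  Choose a rational functional \<open>\<phi>\<close> with \<open>\<phi>(v\<^sub>a) = 1\<close>. Then \<open>c\<^sup>j = \<phi>(\<theta>\<^sup>s\<^sup>j v\<^sub>a)\<close> is a combination of the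
  finitely many numbers \<open>\<phi>(v\<^sub>b)\<close> with walk counts as coefficients, so the powers of \<open>c\<close> have a common
  denominator.
\<close>

lemma eigenvalue_rational_power_int:
  assumes ev: "eigen \<theta> v" and nz: "v a \<noteq> 0" and c: "\<theta> ^ s = of_rat c"
  shows "c \<in> \<int>"
proof -
  obtain \<phi> :: "complex \<Rightarrow> rat" where \<phi>: "\<phi> (v a) = 1" "\<And>y z. \<phi> (y + z) = \<phi> y + \<phi> z"
      "\<And>q y. \<phi> (of_rat q * y) = q * \<phi> y"
    using rational_functional[OF nz] by auto
  have \<phi>0: "\<phi> 0 = 0" using \<phi>(3)[of 0 0] by simp
  have \<phi>sum: "\<phi> (sum f I) = (\<Sum>i\<in>I. \<phi> (f i))" for f and I :: "'a set"
    by (induction I rule: infinite_finite_induct) (auto simp: \<phi>0 \<phi>)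
  have \<phi>nat: "\<phi> (y * of_nat k) = \<phi> y * of_nat k" for y k
    using \<phi>(3)[of "of_nat k" y] by (simp add: mult.commute)
  obtain D :: int where D: "D > 0" "\<And>b. b \<in> V \<Longrightarrow> of_int D * \<phi> (v b) \<in> \<int>"
    using common_denominator[OF fin, of "\<lambda>b. \<phi> (v b)"] by auto
  have "of_int D * c ^ j \<in> \<int>" for j
  proof -
    have "\<theta> ^ (s * j) = of_rat (c ^ j)" by (simp add: power_mult c of_rat_power)
    then have "of_rat (c ^ j) * v a = (\<Sum>b\<in>V. v b * of_nat (walks (s * j) b))"
      using eigen_walks[OF ev, of "s * j"] by simp
    then have "c ^ j = (\<Sum>b\<in>V. \<phi> (v b) * of_nat (walks (s * j) b))"
      using \<phi>(3)[of "c ^ j" "v a"] by (simp add: \<phi>sum \<phi>nat \<phi>(1))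
    then have "of_int D * c ^ j = (\<Sum>b\<in>V. (of_int D * \<phi> (v b)) * of_nat (walks (s * j) b))"
      by (simp add: sum_distrib_left mult.assoc)
    also have "\<dots> \<in> \<int>" by (intro Ints_sum Ints_mult[OF _ Ints_of_nat] D(2))
    finally show ?thesis .
  qed
  then show ?thesis using D(1) by (intro rat_int_if_powers_bounded_denominator[of D c]) auto
qed

text \<open>
  The set \<open>R j\<close> of end vertices of walks of length \<open>j\<close> has at most \<open>k\<^sup>j\<close> elements. At a vertex of
  \<open>R (degree p)\<close> the relation \<open>p(A) e\<^sub>a = 0\<close> requires a nonzero entry of some \<open>A\<^sup>j e\<^sub>a\<close> with
  \<open>j < degree p\<close>, so the sets \<open>R j\<close> with \<open>j < degree p\<close> already cover a set that is closed under taking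
  neighbours.
\<close>

lemma card_V_le:
  assumes p: "minimal p" and D: "degree p \<le> D" and k: "\<And>b. b \<in> V \<Longrightarrow> card (N b) \<le> k"
  shows "card V \<le> (\<Sum>j<D. k ^ j)"
proof -
  define R where "R = (\<lambda>j. {b \<in> V. walks j b \<noteq> 0})"
  have finR: "finite (R j)" for j using fin by (simp add: R_def)
  have step: "b \<in> R (Suc j) \<longleftrightarrow> b \<in> V \<and> (\<exists>c\<in>R j. c \<in> N b)" for b j
  proof -
    have "walks (Suc j) b \<noteq> 0 \<longleftrightarrow> (\<exists>c\<in>N b. walks j c \<noteq> 0)" if "b \<in> V"
      using finN[OF that] by simp
    then show ?thesis using N_sub by (auto simp: R_def)
  qed
  have cardR: "card (R j) \<le> k ^ j" for j
  proof (induction j)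
    case 0
    have "R 0 \<subseteq> {a}" by (auto simp: R_def)
    then show ?case using card_mono[of "{a}" "R 0"] by simp
  next
    case (Suc j)
    have "R (Suc j) \<subseteq> (\<Union>c\<in>R j. N c)"
    proof
      fix b assume "b \<in> R (Suc j)"
      then obtain c where "b \<in> V" "c \<in> R j" "c \<in> N b" using step by blast
      then show "b \<in> (\<Union>c\<in>R j. N c)" using N_sym[of b c] by (auto simp: R_def)
    qed
    moreover have "finite (\<Union>c\<in>R j. N c)" using finR finN by (auto simp: R_def)
    ultimately have "card (R (Suc j)) \<le> card (\<Union>c\<in>R j. N c)" by (intro card_mono)
    also have "\<dots> \<le> (\<Sum>c\<in>R j. card (N c))" by (rule card_UN_le[OF finR])
    also have "\<dots> \<le> (\<Sum>c\<in>R j. k)" using k by (intro sum_mono) (auto simp: R_def)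
    also have "\<dots> \<le> k ^ Suc j" using Suc by (simp add: mult.commute)
    finally show ?case .
  qed
  have ann: "krylov p b = 0" if "b \<in> V" for b using p that by (auto simp: minimal_def annihilates_def)
  have top: "coeff p (degree p) = 1" using p by (simp add: minimal_def)
  have deg0: "degree p > 0"
  proof (rule ccontr)
    assume "\<not> degree p > 0"
    then have "krylov p a = 1" using top by (simp add: krylov_def)
    then show False using ann[OF root] by simp
  qed
  define S where "S = (\<Union>j<degree p. R j)"
  have "S = V"
  proof (rule conn)
    show "a \<in> S" using deg0 root by (auto simp: S_def R_def intro!: bexI[of _ 0])
    show "S \<subseteq> V" by (auto simp: S_def R_def)
    fix b assume "b \<in> S"
    then obtain j where j: "j < degree p" "b \<in> R j" by (auto simp: S_def)
    then have bV: "b \<in> V" by (simp add: R_def)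
    show "N b \<subseteq> S"
    proof
      fix c assume c: "c \<in> N b"
      then have cV: "c \<in> V" and "b \<in> N c" using N_sub[OF bV] N_sym[OF bV] by auto
      then have cR: "c \<in> R (Suc j)" using step j by blast
      show "c \<in> S"
      proof (cases "Suc j < degree p")
        case True then show ?thesis using cR by (auto simp: S_def)
      next
        case False
        then have "degree p = Suc j" using j by simp
        then have "krylov p c = (\<Sum>i<degree p. coeff p i * of_nat (walks i c)) + of_nat (walks (degree p) c)"
          unfolding krylov_def using top by (simp flip: lessThan_Suc_atMost)
        then have "(\<Sum>i<degree p. coeff p i * of_nat (walks i c)) \<noteq> 0"
          using ann[OF cV] cR \<open>degree p = Suc j\<close> by (auto simp del: walks.simps simp: R_def)
        then obtain i where "i < degree p" "walks i c \<noteq> 0" by (metis (no_types, lifting) lessThan_iff mult_zero_right of_nat_0 sum.neutral)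
        then show ?thesis using cV by (auto simp: S_def R_def)
      qed
    qed
  qed
  then have "card V \<le> (\<Sum>j<degree p. card (R j))" unfolding S_def by (metis card_UN_le finite_lessThan)
  also have "\<dots> \<le> (\<Sum>j<degree p. k ^ j)" by (intro sum_mono cardR)
  also have "\<dots> \<le> (\<Sum>j<D. k ^ j)" using D by (intro sum_mono2) auto
  finally show ?thesis .
qed

text \<open>
  The roots \<open>\<Theta>\<close> are simple, so their number is the degree. For a nonzero root \<open>z\<close>, the power of \<open>z\<close> whose
  exponent is the number of nonzero roots is the product of the nonzero roots times a product of ratios, hence
  rational, hence an integer. So the roots are separated by 1 and lie in \<open>[-k, k]\<close>.
\<close>

lemma degree_minimal_le:
  assumes p: "minimal p" and k: "\<And>b. b \<in> V \<Longrightarrow> card (N b) \<le> k"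
    and ratio: "\<And>x y. poly p x = 0 \<Longrightarrow> poly p y = 0 \<Longrightarrow> y \<noteq> 0 \<Longrightarrow> x / y \<in> \<rat>"
  shows "degree p \<le> 2 * k + 1"
proof -
  define \<Theta> where "\<Theta> = {z. poly p z = 0}"
  have p0: "p \<noteq> 0" using p by (auto simp: minimal_def)
  have fin\<Theta>: "finite \<Theta>" using poly_roots_finite[OF p0] by (simp add: \<Theta>_def)
  have "rsquarefree p" using minimal_root(2)[OF p] by (auto simp: rsquarefree_roots)
  from complex_poly_decompose_rsquarefree[OF this] have dec: "p = (\<Prod>z\<in>\<Theta>. [:-z, 1:])"
    using p by (simp add: \<Theta>_def minimal_def)
  have deg: "degree p = card \<Theta>" by (subst dec, subst degree_prod_sum_eq) auto
  define \<Theta>' where "\<Theta>' = \<Theta> - {0}"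
  \<comment> \<open>The maximum makes the exponent positive also when 0 is the only root.\<close>
  define s where "s = max 1 (card \<Theta>')"
  have real: "of_real (Re z) = z" if "z \<in> \<Theta>" for z
    using minimal_root(1)[OF p, of z] that by (simp add: \<Theta>_def)
  have prod_rat: "(\<Prod>z\<in>\<Theta>'. -z) \<in> \<rat>"
  proof (cases "0 \<in> \<Theta>")
    case False
    then have "\<Theta>' = \<Theta>" by (simp add: \<Theta>'_def)
    then have "(\<Prod>z\<in>\<Theta>'. -z) = poly p 0" by (subst dec) (simp add: poly_prod)
    then show ?thesis using minimal_rational[OF p, of 0] by (simp add: poly_0_coeff_0)
  next
    case True
    then have "p = [:0, 1:] * (\<Prod>z\<in>\<Theta>'. [:-z, 1:])"
      using fin\<Theta> by (subst dec) (simp add: \<Theta>'_def prod.remove[of \<Theta> 0])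
    then have "coeff p 1 = poly (\<Prod>z\<in>\<Theta>'. [:-z, 1:]) 0" by (simp add: poly_0_coeff_0)
    also have "\<dots> = (\<Prod>z\<in>\<Theta>'. -z)" by (simp add: poly_prod)
    finally show ?thesis using minimal_rational[OF p, of 1] by simp
  qed
  have pow: "\<exists>m::int. z ^ s = of_int m" if z: "z \<in> \<Theta>" for z
  proof (cases "z = 0")
    case True then show ?thesis by (intro exI[of _ 0]) (simp add: s_def)
  next
    case False
    obtain v where v: "eigen z v" "v a \<noteq> 0" using minimal_root(3)[OF p, of z] z by (auto simp: \<Theta>_def)
    have "(\<Prod>y\<in>\<Theta>'. z / y) \<in> \<rat>"
      using ratio[of z] z by (intro Rats_prod) (auto simp: \<Theta>'_def \<Theta>_def)
    moreover have "z ^ card \<Theta>' = (\<Prod>y\<in>\<Theta>'. z / y) * (\<Prod>y\<in>\<Theta>'. y)"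
    proof -
      have "(\<Prod>y\<in>\<Theta>'. z / y) * (\<Prod>y\<in>\<Theta>'. y) = (\<Prod>y\<in>\<Theta>'. z / y * y)" by (simp only: prod.distrib)
      also have "\<dots> = (\<Prod>y\<in>\<Theta>'. z)" by (intro prod.cong) (auto simp: \<Theta>'_def)
      finally show ?thesis by simp
    qed
    moreover have "(\<Prod>y\<in>\<Theta>'. y) = (-1) ^ card \<Theta>' * (\<Prod>y\<in>\<Theta>'. -y)"
      by (simp add: prod_uminus power_mult_distrib[symmetric] mult.assoc[symmetric])
    ultimately have "z ^ card \<Theta>' \<in> \<rat>" using prod_rat by simp
    moreover have "s = card \<Theta>'"
    proof -
      have "z \<in> \<Theta>'" using z False by (simp add: \<Theta>'_def)
      then have "card \<Theta>' > 0" using fin\<Theta> by (auto simp: card_gt_0_iff \<Theta>'_def)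
      then show ?thesis by (simp add: s_def)
    qed
    ultimately obtain c where c: "z ^ s = of_rat c" by (auto elim: Rats_cases)
    then have "c \<in> \<int>" using eigenvalue_rational_power_int[OF v] by blast
    then obtain m where "c = of_int m" by (auto elim: Ints_cases)
    then show ?thesis using c by auto
  qed
  have inj: "inj_on Re \<Theta>" using real by (metis inj_onI)
  have "card (Re ` \<Theta>) \<le> 2 * k + 1"
  proof (rule card_separated_le)
    fix x assume "x \<in> Re ` \<Theta>"
    then obtain z where z: "z \<in> \<Theta>" "x = Re z" by auto
    obtain v where v: "eigen z v" "v a \<noteq> 0" using minimal_root(3)[OF p, of z] z by (auto simp: \<Theta>_def)
    show "\<bar>x\<bar> \<le> real k" using eigenvalue_bound[OF v k] abs_Re_le_cmod[of z] z(2) by simp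
  next
    fix x y assume xy: "x \<in> Re ` \<Theta>" "y \<in> Re ` \<Theta>" "x \<noteq> y"
    then obtain z1 z2 where z: "z1 \<in> \<Theta>" "z2 \<in> \<Theta>" "x = Re z1" "y = Re z2" by auto
    then have zr: "z1 = of_real x" "z2 = of_real y" using real by simp_all
    obtain m n :: int where mn: "z1 ^ s = of_int m" "z2 ^ s = of_int n" using pow z by metis
    have "complex_of_real (x ^ s) = complex_of_real (of_int m)" "complex_of_real (y ^ s) = complex_of_real (of_int n)"
      using mn by (simp_all add: zr)
    then have xs: "x ^ s = of_int m" "y ^ s = of_int n" by (simp_all only: of_real_eq_iff)
    have "x / y \<in> \<rat>" if "y \<noteq> 0"
    proof -
      have "poly p z1 = 0" "poly p z2 = 0" using z(1,2) by (simp_all add: \<Theta>_def)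
      moreover have "z2 \<noteq> 0" using that zr(2) by simp
      ultimately have "z1 / z2 \<in> \<rat>" by (rule ratio)
      then obtain u w :: int where "w > 0" "coprime u w" "z1 / z2 = of_int u / of_int w"
        by (rule Rats_cases') blast
      then have "complex_of_real (x / y) = complex_of_real (of_int u / of_int w)" by (simp add: zr)
      then have "x / y = of_int u / of_int w" by (simp only: of_real_eq_iff)
      then show ?thesis by simp
    qed
    then show "\<bar>x - y\<bar> \<ge> 1"
      using gap_of_commensurable_radicals[OF _ xs xy(3)] by (simp add: s_def)
  qed
  then show ?thesis using deg inj by (simp add: card_image)
qed

lemma walks_le: "b \<in> V \<Longrightarrow> walks m b \<le> card V ^ m"
proof (induction m arbitrary: b)
  case 0 then show ?case by simp
next
  case (Suc m)
  have "walks (Suc m) b \<le> (\<Sum>c\<in>N b. card V ^ m)"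
    unfolding walks.simps using N_sub[OF Suc.prems] by (intro sum_mono Suc.IH) auto
  also have "\<dots> \<le> card V * card V ^ m"
    using N_sub[OF Suc.prems] fin by (simp add: card_mono)
  finally show ?case by simp
qed

text \<open>
  For \<open>s = it\<close> this is the entry of \<open>exp(itA)\<close> at row \<open>b\<close> and column \<open>a\<close>.
\<close>

definition amplitude :: "complex \<Rightarrow> 'a \<Rightarrow> complex" where
  "amplitude s b = (\<Sum>m. s ^ m * of_nat (walks m b) / fact m)"

lemma amplitude_sums:
  assumes "b \<in> V"
  shows "(\<lambda>m. s ^ m * of_nat (walks m b) / fact m) sums amplitude s b"
  unfolding amplitude_def
proof (rule summable_sums, rule summable_comparison_test')
  show "summable (\<lambda>m. inverse (fact m) * (norm s * real (card V)) ^ m)" by (rule summable_exp)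
  fix m assume "m \<ge> (0::nat)"
  have "real (walks m b) \<le> real (card V ^ m)" using walks_le[OF assms, of m] by (simp only: of_nat_le_iff)
  then have "norm s ^ m * real (walks m b) / fact m \<le> norm s ^ m * real (card V ^ m) / fact m"
    by (intro divide_right_mono mult_left_mono) auto
  moreover have "norm (fact m :: complex) = fact m" by (metis norm_of_nat of_nat_fact)
  then have "norm (s ^ m * of_nat (walks m b) / fact m) = norm s ^ m * real (walks m b) / fact m"
    by (simp only: norm_mult norm_divide norm_power norm_of_nat)
  ultimately show "norm (s ^ m * of_nat (walks m b) / fact m) \<le> inverse (fact m) * (norm s * real (card V)) ^ m"
    by (simp add: power_mult_distrib field_simps)
qed

text \<open>
  The identity \<open>\<langle>v, A\<^sup>m e\<^sub>a\<rangle> = \<theta>\<^sup>m v\<^sub>a\<close>, summed over the exponential series.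
\<close>

lemma eigen_amplitude:
  assumes "eigen \<theta> v"
  shows "(\<Sum>b\<in>V. v b * amplitude s b) = exp (s * \<theta>) * v a"
proof -
  have "(\<lambda>m. \<Sum>b\<in>V. v b * (s ^ m * of_nat (walks m b) / fact m)) sums (\<Sum>b\<in>V. v b * amplitude s b)"
    by (intro sums_sum sums_mult amplitude_sums)
  moreover have "(\<Sum>b\<in>V. v b * (s ^ m * of_nat (walks m b) / fact m)) = ((s * \<theta>) ^ m /\<^sub>R fact m) * v a" for m
  proof -
    have "(\<Sum>b\<in>V. v b * (s ^ m * of_nat (walks m b) / fact m)) = s ^ m / fact m * (\<Sum>b\<in>V. v b * of_nat (walks m b))"
      by (simp add: sum_distrib_left ac_simps)
    then show ?thesis
      by (simp add: eigen_walks[OF assms] power_mult_distrib scaleR_conv_of_real divide_inverse ac_simps)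
  qed
  ultimately have "(\<lambda>m. ((s * \<theta>) ^ m /\<^sub>R fact m) * v a) sums (\<Sum>b\<in>V. v b * amplitude s b)" by simp
  moreover have "(\<lambda>m. ((s * \<theta>) ^ m /\<^sub>R fact m) * v a) sums (exp (s * \<theta>) * v a)"
    by (intro sums_mult2 exp_converges)
  ultimately show ?thesis by (rule sums_unique2)
qed

text \<open>
  The predicate \<open>side\<close> is membership in one colour class of a bipartition: each step of a walk changes it.
\<close>

lemma walks_parity:
  assumes side: "\<And>b c. b \<in> V \<Longrightarrow> c \<in> N b \<Longrightarrow> side c \<noteq> (side b :: bool)"
  shows "b \<in> V \<Longrightarrow> walks m b \<noteq> 0 \<Longrightarrow> even m \<longleftrightarrow> side b = side a"
proof (induction m arbitrary: b)
  case 0 then show ?case by (auto split: if_splits)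
next
  case (Suc m)
  have "\<exists>c\<in>N b. walks m c \<noteq> 0" using Suc.prems finN by auto
  then obtain c where c: "c \<in> N b" "walks m c \<noteq> 0" by blast
  then have "even m \<longleftrightarrow> side c = side a" using Suc.IH N_sub[OF Suc.prems(1)] by blast
  then show ?case using side[OF Suc.prems(1) c(1)] by auto
qed

lemma amplitude_uminus:
  assumes side: "\<And>b c. b \<in> V \<Longrightarrow> c \<in> N b \<Longrightarrow> side c \<noteq> (side b :: bool)" and b: "b \<in> V"
  shows "amplitude (- s) b = (if side b = side a then 1 else - 1) * amplitude s b"
proof -
  let ?e = "if side b = side a then 1 else - 1 :: complex"
  have "(- s) ^ m * of_nat (walks m b) / fact m = ?e * (s ^ m * of_nat (walks m b) / fact m)" for m
    using walks_parity[of side, OF side b, of m] by (cases "walks m b = 0") (auto simp: power_minus_even power_minus_odd)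
  then have "(\<lambda>m. (- s) ^ m * of_nat (walks m b) / fact m) sums (?e * amplitude s b)"
    using sums_mult[OF amplitude_sums[OF b], of ?e s] by (simp only:)
  then show ?thesis using amplitude_sums[OF b] by (rule sums_unique2[symmetric])
qed

text \<open>
  All eigenvalues \<open>x\<close> in the support are algebraic with algebraic \<open>exp(sx)\<close>; two of them with an irrational
  ratio would be linearly independent over the rationals and contradict the Gelfond-Schneider theorem.
\<close>

lemma card_le_if_amplitudes_algebraic:
  assumes k: "\<And>b. b \<in> V \<Longrightarrow> card (N b) \<le> k" and s: "s \<noteq> 0"
    and alg: "\<And>b. b \<in> V \<Longrightarrow> algebraic (amplitude s b)"
  shows "card V \<le> (\<Sum>j<2 * k + 1. k ^ j)"
proof -
  obtain p where p: "minimal p" using minimal_exists by blast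
  have p0: "p \<noteq> 0" using p by (auto simp: minimal_def)
  have ex: "algebraic x \<and> algebraic (exp (s * x))" if x: "poly p x = 0" for x
  proof
    show "algebraic x" using minimal_rational[OF p] p0 x by (intro algebraicI'[of p]) auto
    obtain v where v: "eigen x v" "v a \<noteq> 0" "\<forall>b\<in>V. algebraic (v b)"
      using minimal_root(3)[OF p x] by blast
    have "exp (s * x) = (\<Sum>b\<in>V. v b * amplitude s b) * inverse (v a)"
      using eigen_amplitude[OF v(1), of s] v(2) by (simp add: field_simps)
    moreover have "algebraic \<dots>"
      using v alg root by (intro algebraic_mult algebraic_sum algebraic_inverse) auto
    ultimately show "algebraic (exp (s * x))" by simp
  qed
  have "x / y \<in> \<rat>" if "poly p x = 0" "poly p y = 0" "y \<noteq> 0" for x y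
  proof (rule ccontr)
    assume irr: "x / y \<notin> \<rat>"
    have lin: "m = 0 \<and> n = 0" if mn: "of_int m * x + of_int n * y = 0" for m n :: int
    proof (cases "m = 0")
      case True then show ?thesis using mn \<open>y \<noteq> 0\<close> by simp
    next
      case False
      have "of_int m * x = - of_int n * y" using mn by (simp add: add_eq_0_iff)
      then have "x / y = - of_int n / of_int m" using False \<open>y \<noteq> 0\<close> by (simp add: field_simps)
      then show ?thesis using irr by simp
    qed
    have "algebraic x" "algebraic y" "algebraic (exp (s * x))" "algebraic (exp (s * y))"
      using ex that(1,2) by blast+
    then show False using s lin by (rule gelfond_schneider)
  qed
  then have "degree p \<le> 2 * k + 1" using degree_minimal_le[OF p k] by blast
  then show ?thesis by (rule card_V_le[OF p _ k])
qed

end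

section \<open>Transition matrices and local uniform mixing\<close>

lemma rooted_graph_of_pair_graph:
  assumes G: "pair_graph G" and conn: "connected (with_proj G)" and a: "a \<in> pverts G"
  shows "rooted_graph (pverts G) (\<lambda>b. {c. (b, c) \<in> parcs G}) a"
proof -
  interpret pair_graph G by (rule G)
  have sym: "symmetric (with_proj G)" by (rule pair_sym_arcs)
  show ?thesis
  proof
    show "finite (pverts G)" by (rule pair_finite_verts)
    show "a \<in> pverts G" by (rule a)
    show "{c. (b, c) \<in> parcs G} \<subseteq> pverts G" for b using arc_snd_in_verts by fastforce
    show "c \<in> {c. (b, c) \<in> parcs G} \<longleftrightarrow> b \<in> {c'. (c, c') \<in> parcs G}" for b c
      using arcs_ends_symmetric[OF sym] by auto
    fix S assume S: "a \<in> S" "S \<subseteq> pverts G" "\<And>b. b \<in> S \<Longrightarrow> {c. (b, c) \<in> parcs G} \<subseteq> S"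
    have "b \<in> S" if b: "b \<in> pverts G" for b
    proof -
      have "a \<rightarrow>\<^sup>*\<^bsub>mk_symmetric (with_proj G)\<^esub> b"
        using conn a b by (auto simp: connected_def strongly_connected_def)
      then have "a \<rightarrow>\<^sup>*\<^bsub>with_proj G\<^esub> b" by (simp only: reachable_mk_symmetric_eq[OF sym])
      then have "(a, b) \<in> (parcs G)\<^sup>*" by (auto dest: reachable_rtranclI)
      then show "b \<in> S"
        by (induction rule: rtrancl_induct) (use S in auto)
    qed
    then show "S = pverts G" using S(2) by blast
  qed
qed

lemma card_neighbours_le_max_valency:
  assumes G: "pair_graph G" and b: "b \<in> pverts G"
  shows "card {c. (b, c) \<in> parcs G} \<le> max_valency G"
proof -
  interpret pair_graph G by (rule G)
  have "out_arcs (with_proj G) b = Pair b ` {c. (b, c) \<in> parcs G}" by (auto simp: out_arcs_def)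
  then have "out_degree (with_proj G) b = card {c. (b, c) \<in> parcs G}"
    by (simp add: out_degree_def card_image inj_on_def)
  then show ?thesis unfolding max_valency_def
    using b pair_finite_verts by (metis Max_ge finite_imageI imageI)
qed

lemma pow_mat_Suc_left:
  assumes A: "(A :: complex mat) \<in> carrier_mat n n"
  shows "A ^\<^sub>m Suc m = A * A ^\<^sub>m m"
proof (induction m)
  case 0 then show ?case using A by simp
next
  case (Suc m)
  have P: "A ^\<^sub>m m \<in> carrier_mat n n" using A by (rule pow_carrier_mat)
  have "A ^\<^sub>m Suc (Suc m) = A * A ^\<^sub>m m * A" using Suc by simp
  also have "\<dots> = A * (A ^\<^sub>m m * A)" by (rule assoc_mult_mat[OF A P A])
  finally show ?case by simp
qed

lemma smult_pow_mat:
  assumes A: "(A :: complex mat) \<in> carrier_mat n n"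
  shows "(x \<cdot>\<^sub>m A) ^\<^sub>m m = x ^ m \<cdot>\<^sub>m (A ^\<^sub>m m)"
proof (induction m)
  case 0 then show ?case using A by (auto intro!: eq_matI)
next
  case (Suc m)
  have P: "A ^\<^sub>m m \<in> carrier_mat n n" using A by (rule pow_carrier_mat)
  have "(x \<cdot>\<^sub>m A) ^\<^sub>m Suc m = x ^ m \<cdot>\<^sub>m (x \<cdot>\<^sub>m (A ^\<^sub>m m * A))"
    by (simp add: Suc mult_smult_assoc_mat[OF P smult_carrier_mat[OF A]] mult_smult_distrib[OF P A])
  then show ?case by (auto intro!: eq_matI simp: ac_simps)
qed

lemma mult_mat_entry:
  assumes "A \<in> carrier_mat n n" "B \<in> carrier_mat n n" "i < n" "j < n"
  shows "(A * B) $$ (i, j) = (\<Sum>l<n. A $$ (i, l) * B $$ (l, j) :: complex)"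
  using assms by (simp add: scalar_prod_def atLeast0LessThan)

context rooted_graph
begin

context
  fixes G :: "'a pair_pre_digraph" and vs :: "'a list" and i :: nat
  assumes VG: "V = pverts G" and NG: "\<And>b. N b = {c. (b, c) \<in> parcs G}"
    and vs: "distinct vs" "set vs = pverts G" "i < length vs" "vs ! i = a"
begin

lemma adjacency_carrier: "adjacency_mat G vs \<in> carrier_mat (length vs) (length vs)"
  by (simp add: adjacency_mat_def)

lemma sum_neighbours_index:
  assumes r: "r < length vs"
  shows "(\<Sum>l<length vs. if (vs ! r, vs ! l) \<in> parcs G then f (vs ! l) else 0) = (\<Sum>c\<in>N (vs ! r). f c :: complex)"
proof -
  have "bij_betw ((!) vs) {..<length vs} V" using bij_betw_nth[OF vs(1) refl refl] vs(2) VG by simp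
  from sum.reindex_bij_betw[OF this, of "\<lambda>c. if (vs ! r, c) \<in> parcs G then f c else 0"]
  have "(\<Sum>l<length vs. if (vs ! r, vs ! l) \<in> parcs G then f (vs ! l) else 0)
      = (\<Sum>c\<in>V. if (vs ! r, c) \<in> parcs G then f c else 0)" .
  also have "\<dots> = (\<Sum>c\<in>{c \<in> V. (vs ! r, c) \<in> parcs G}. f c)" by (rule sum.inter_filter[OF fin, symmetric])
  also have "{c \<in> V. (vs ! r, c) \<in> parcs G} = N (vs ! r)"
    using N_sub[of "vs ! r"] NG[of "vs ! r"] r vs(2) VG nth_mem by auto
  finally show ?thesis .
qed

text \<open>
  Row \<open>i\<close> and column \<open>i\<close> are treated together because the state at time \<open>t\<close> involves column \<open>i\<close> of
  \<open>U(t)\<close> and row \<open>i\<close> of \<open>U(-t)\<close>.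
\<close>

lemma adjacency_pow:
  assumes "r < length vs"
  shows "(adjacency_mat G vs ^\<^sub>m m) $$ (r, i) = of_nat (walks m (vs ! r))"
    and "(adjacency_mat G vs ^\<^sub>m m) $$ (i, r) = of_nat (walks m (vs ! r))"
proof -
  define A where "A = adjacency_mat G vs"
  define n where "n = length vs"
  have A: "A \<in> carrier_mat n n" using adjacency_carrier by (simp add: A_def n_def)
  have P: "A ^\<^sub>m m \<in> carrier_mat n n" for m using A by (rule pow_carrier_mat)
  have Ai: "A $$ (r, l) = (if (vs ! r, vs ! l) \<in> parcs G then 1 else 0)" if "r < n" "l < n" for r l
    using that by (simp add: A_def adjacency_mat_def n_def)
  have sym: "(vs ! l, vs ! r) \<in> parcs G \<longleftrightarrow> (vs ! r, vs ! l) \<in> parcs G" if "r < n" "l < n" for r l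
  proof -
    have "vs ! l \<in> V" "vs ! r \<in> V" using that vs(2) VG nth_mem by (auto simp: n_def)
    then show ?thesis using N_sym[of "vs ! l" "vs ! r"] by (simp add: NG)
  qed
  have i: "i < n" using vs by (simp add: n_def)
  have base: "r = i \<longleftrightarrow> vs ! r = a" if "r < n" for r
    using that vs nth_eq_iff_index_eq[OF vs(1), of r i] by (auto simp: n_def)
  have "(A ^\<^sub>m m) $$ (r, i) = of_nat (walks m (vs ! r)) \<and> (A ^\<^sub>m m) $$ (i, r) = of_nat (walks m (vs ! r))"
    if "r < n" for r
    using that
  proof (induction m arbitrary: r)
    case 0
    then show ?case using A i base[of r] by auto
  next
    case (Suc m)
    have "(A ^\<^sub>m Suc m) $$ (r, i) = (\<Sum>l<n. A $$ (r, l) * (A ^\<^sub>m m) $$ (l, i))"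
      unfolding pow_mat_Suc_left[OF A] by (rule mult_mat_entry[OF A P Suc.prems i])
    also have "\<dots> = (\<Sum>l<n. if (vs ! r, vs ! l) \<in> parcs G then of_nat (walks m (vs ! l)) else 0)"
      using Suc by (intro sum.cong) (auto simp: Ai)
    also have "\<dots> = of_nat (walks (Suc m) (vs ! r))"
      using sum_neighbours_index[of r "\<lambda>c. of_nat (walks m c)"] Suc.prems by (simp add: n_def)
    finally have 1: "(A ^\<^sub>m Suc m) $$ (r, i) = of_nat (walks (Suc m) (vs ! r))" .
    have "(A ^\<^sub>m Suc m) $$ (i, r) = (\<Sum>l<n. (A ^\<^sub>m m) $$ (i, l) * A $$ (l, r))"
      unfolding pow_mat.simps by (rule mult_mat_entry[OF P A i Suc.prems])
    also have "\<dots> = (\<Sum>l<n. if (vs ! r, vs ! l) \<in> parcs G then of_nat (walks m (vs ! l)) else 0)"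
      using Suc sym by (intro sum.cong) (auto simp: Ai)
    also have "\<dots> = of_nat (walks (Suc m) (vs ! r))"
      using sum_neighbours_index[of r "\<lambda>c. of_nat (walks m c)"] Suc.prems by (simp add: n_def)
    finally show ?case using 1 by blast
  qed
  then show "(adjacency_mat G vs ^\<^sub>m m) $$ (r, i) = of_nat (walks m (vs ! r))"
    and "(adjacency_mat G vs ^\<^sub>m m) $$ (i, r) = of_nat (walks m (vs ! r))"
    using assms by (simp_all add: A_def n_def)
qed

lemma transition_mat_amplitude:
  assumes r: "r < length vs"
  shows "transition_mat G vs t $$ (r, i) = amplitude (\<i> * of_real t) (vs ! r)"
    and "transition_mat G vs t $$ (i, r) = amplitude (\<i> * of_real t) (vs ! r)"
proof -
  have d: "dim_row (adjacency_mat G vs) = length vs" "dim_col (adjacency_mat G vs) = length vs"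
    by (simp_all add: adjacency_mat_def)
  show "transition_mat G vs t $$ (r, i) = amplitude (\<i> * of_real t) (vs ! r)"
    "transition_mat G vs t $$ (i, r) = amplitude (\<i> * of_real t) (vs ! r)"
    using r vs(3) by (simp_all add: transition_mat_def mat_exp_def amplitude_def d
        smult_pow_mat[OF adjacency_carrier] adjacency_pow)
qed

lemma state_at_diag:
  assumes r: "r < length vs"
  shows "state_at G vs i t $$ (r, r) = amplitude (\<i> * of_real t) (vs ! r) * amplitude (- (\<i> * of_real t)) (vs ! r)"
proof -
  define n where "n = length vs"
  have U: "transition_mat G vs t \<in> carrier_mat n n" for t
    by (simp add: transition_mat_def mat_exp_def adjacency_mat_def n_def)
  have D: "vertex_state n i \<in> carrier_mat n n" by (simp add: vertex_state_def)
  have Di: "vertex_state n i $$ (l, j) = (if l = i \<and> j = i then 1 else 0)" if "l < n" "j < n" for l j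
    using that vs(3) by (simp add: vertex_state_def n_def)
  have rn: "r < n" and i: "i < n" using r vs(3) by (simp_all add: n_def)
  have UD: "(transition_mat G vs t * vertex_state n i) $$ (r, j) = (if j = i then transition_mat G vs t $$ (r, i) else 0)"
    if j: "j < n" for j
  proof -
    have "(transition_mat G vs t * vertex_state n i) $$ (r, j)
        = (\<Sum>l<n. transition_mat G vs t $$ (r, l) * vertex_state n i $$ (l, j))"
      by (rule mult_mat_entry[OF U D rn j])
    also have "\<dots> = (\<Sum>l<n. if l = i then (if j = i then transition_mat G vs t $$ (r, i) else 0) else 0)"
      using j by (intro sum.cong) (auto simp: Di)
    finally show ?thesis using i by simp
  qed
  have "state_at G vs i t $$ (r, r)
      = (\<Sum>j<n. (transition_mat G vs t * vertex_state n i) $$ (r, j) * transition_mat G vs (- t) $$ (j, r))"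
    unfolding state_at_def n_def[symmetric] by (rule mult_mat_entry[OF mult_carrier_mat[OF U D] U rn rn])
  also have "\<dots> = (\<Sum>j<n. if j = i then transition_mat G vs t $$ (r, i) * transition_mat G vs (- t) $$ (i, r) else 0)"
    by (intro sum.cong) (auto simp: UD)
  also have "\<dots> = transition_mat G vs t $$ (r, i) * transition_mat G vs (- t) $$ (i, r)" using i by simp
  finally show ?thesis using transition_mat_amplitude[OF r] by simp
qed

end
end

text \<open>
  Mixing says that \<open>U(t)\<^sub>b\<^sub>a U(-t)\<^sub>a\<^sub>b = 1/n\<close>, and by bipartiteness \<open>U(-t)\<^sub>a\<^sub>b\<close> is \<open>U(t)\<^sub>b\<^sub>a\<close> or its negative. So
  each amplitude has a rational square.
\<close>

lemma local_uniform_mixing_card_le: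
  assumes G: "pair_graph G" "connected (with_proj G)" "bipartite G" "max_valency G \<le> k"
    and a: "a \<in> pverts G" and mix: "local_uniform_mixing G a"
  shows "card (pverts G) \<le> (\<Sum>j<2 * k + 1. k ^ j)"
proof -
  interpret rooted_graph "pverts G" "\<lambda>b. {c. (b, c) \<in> parcs G}" a
    by (rule rooted_graph_of_pair_graph[OF G(1,2) a])
  define n where "n = card (pverts G)"
  obtain vs i t where vs: "distinct vs" "set vs = pverts G" "i < length vs" "vs ! i = a"
    and eq: "schur_product (state_at G vs i t) (1\<^sub>m (length vs)) =
      (1 / of_nat (card (pverts G))) \<cdot>\<^sub>m 1\<^sub>m (length vs)"
    using mix unfolding local_uniform_mixing_def by blast
  have len: "length vs = n" using vs by (metis distinct_card n_def)
  define s where "s = \<i> * of_real t"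
  have amp: "amplitude s b * amplitude (- s) b = 1 / of_nat n" if b: "b \<in> pverts G" for b
  proof -
    obtain r where r: "r < length vs" "vs ! r = b" using b vs(2) by (metis in_set_conv_nth)
    have d: "dim_row (state_at G vs i t) = length vs" "dim_col (state_at G vs i t) = length vs"
      by (simp_all add: state_at_def transition_mat_def mat_exp_def adjacency_mat_def)
    have "schur_product (state_at G vs i t) (1\<^sub>m (length vs)) $$ (r, r) = state_at G vs i t $$ (r, r)"
      using r by (simp add: schur_product_def d)
    then have "state_at G vs i t $$ (r, r) = 1 / of_nat n" using r unfolding eq by (simp add: n_def)
    then show ?thesis using state_at_diag[OF refl refl vs r(1), of t] r(2) by (simp add: s_def)
  qed
  obtain X Y where XY: "pverts G = X \<union> Y" "X \<inter> Y = {}" "parcs G \<subseteq> X \<times> Y \<union> Y \<times> X"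
    using G(3) unfolding bipartite_def by blast
  have side: "(c \<in> X) \<noteq> (b \<in> X)" if "c \<in> {c. (b, c) \<in> parcs G}" for b c
    using that XY by auto
  have alg: "algebraic (amplitude s b)" if b: "b \<in> pverts G" for b
  proof -
    have "amplitude s b * amplitude s b = 1 / of_nat n \<or> amplitude s b * amplitude s b = - (1 / of_nat n)"
      using amplitude_uminus[of "\<lambda>c. c \<in> X" b s] side b amp[OF b] by (auto split: if_splits simp: minus_equation_iff)
    then have "(amplitude s b)\<^sup>2 \<in> \<rat>" by (auto simp: power2_eq_square)
    then have "algebraic ((amplitude s b)\<^sup>2)" by (rule rat_imp_algebraic)
    then show ?thesis
      by (rule algebraic_root[where p = "monom 1 2"]) (auto simp: poly_monom degree_monom_eq)
  qed
  have one: "1 \<le> (\<Sum>j<2 * k + 1. k ^ j)"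
    using member_le_sum[of 0 "{..<2 * k + 1}" "\<lambda>j. k ^ j"] by simp
  show ?thesis
  proof (cases "t = 0")
    case True
    then have "amplitude s a = 1" "amplitude (- s) a = 1"
      unfolding amplitude_def s_def by (subst suminf_finite[of "{0}"]; simp add: power_0_left)+
    then have "of_nat n = (1::complex)" using amp[OF a] by (simp add: field_simps split: if_splits)
    then have "n = 1" by (simp only: of_nat_eq_1_iff)
    then show ?thesis using one by (simp add: n_def)
  next
    case False
    show ?thesis
    proof (rule card_le_if_amplitudes_algebraic)
      show "s \<noteq> 0" using False by (simp add: s_def)
      show "card {c. (b, c) \<in> parcs G} \<le> k" if "b \<in> pverts G" for b
        using card_neighbours_le_max_valency[OF G(1) that] G(4) by simp
      show "algebraic (amplitude s b)" if "b \<in> pverts G" for b by (rule alg[OF that])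
    qed
  qed
qed

section \<open>Isomorphism classes of bounded order\<close>

text \<open>
  The isomorphism is \<open>h\<^sup>-\<^sup>1 \<circ> g\<close>.
\<close>

lemma digraph_iso_if_same_relabelling:
  fixes G H :: "'a pair_pre_digraph" and g h :: "'a \<Rightarrow> 'b"
  assumes G: "pair_wf_digraph G" and H: "pair_wf_digraph H"
    and inj: "inj_on g (pverts G)" "inj_on h (pverts H)"
    and verts: "g ` pverts G = h ` pverts H"
    and arcs: "map_prod g g ` parcs G = map_prod h h ` parcs H"
  shows "digraph_iso (with_proj G) (with_proj H)"
proof -
  define f where "f = inv_into (pverts H) h \<circ> g"
  define F where "F = \<lparr>iso_verts = f, iso_arcs = map_prod f f, iso_head = snd, iso_tail = fst\<rparr>"
  have PG: "parcs G \<subseteq> pverts G \<times> pverts G" and PH: "parcs H \<subseteq> pverts H \<times> pverts H"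
    using G H by (auto simp: pair_wf_digraph_def)
  have inv: "inv_into (pverts H) h (h v) = v" if "v \<in> pverts H" for v using inj(2) that by simp
  have fimg: "f ` pverts G = pverts H"
  proof -
    have "f ` pverts G = inv_into (pverts H) h ` h ` pverts H" by (metis f_def image_comp verts)
    then show ?thesis using inv by (simp add: image_image)
  qed
  have hf: "h (f v) = g v" if "v \<in> pverts G" for v
    using that verts by (auto simp: f_def intro!: f_inv_into_f)
  have finj: "inj_on f (pverts G)" using inj(1) hf by (metis inj_onI inj_onD)
  have aimg: "map_prod f f ` parcs G = parcs H"
  proof -
    have "map_prod f f ` parcs G = map_prod (inv_into (pverts H) h) (inv_into (pverts H) h) ` map_prod g g ` parcs G"
      by (simp add: f_def image_image map_prod_def split_def)
    also have "\<dots> = (\<lambda>e. e) ` parcs H"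
      unfolding arcs image_image using PH inv by (intro image_cong) auto
    finally show ?thesis by simp
  qed
  have "pre_digraph.digraph_isomorphism (with_proj G) F"
    unfolding pre_digraph.digraph_isomorphism_def
  proof (intro conjI ballI)
    show "wf_digraph (with_proj G)" using G by (simp add: wf_digraph_wp_iff)
    show "inj_on (iso_verts F) (verts (with_proj G))" using finj by (simp add: F_def)
    show "inj_on (iso_arcs F) (arcs (with_proj G))"
      using inj_on_subset[OF map_prod_inj_on[OF finj finj] PG] by (simp add: F_def)
  qed (auto simp: F_def)
  moreover have "with_proj H = app_iso F (with_proj G)"
    by (simp add: app_iso_def F_def with_proj_def fimg aimg)
  ultimately show ?thesis unfolding digraph_iso_def by blast
qed

text \<open>
  Numbering the vertices of each graph encodes it by its order and a set of pairs of numbers below \<open>B\<close>. There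
  are finitely many codes, and graphs with the same code have the same isomorphism class.
\<close>

lemma finite_iso_classes_of_bounded_order:
  fixes S :: "'a pair_pre_digraph set"
  assumes S: "\<And>G. G \<in> S \<Longrightarrow> pair_fin_digraph G \<and> card (pverts G) \<le> B"
  shows "finite (S // graph_iso_rel)"
proof -
  have "\<exists>g::'a \<Rightarrow> nat. bij_betw g (pverts G) {..<card (pverts G)}" if "G \<in> S" for G
    using S[OF that] ex_bij_betw_finite_nat[of "pverts G"]
    by (auto simp: pair_fin_digraph_def pair_fin_digraph_axioms_def atLeast0LessThan)
  then obtain g :: "'a pair_pre_digraph \<Rightarrow> 'a \<Rightarrow> nat"
    where g: "\<And>G. G \<in> S \<Longrightarrow> bij_betw (g G) (pverts G) {..<card (pverts G)}" by metis
  define code where "code = (\<lambda>G. (card (pverts G), map_prod (g G) (g G) ` parcs G))"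
  have wf: "pair_wf_digraph G" if "G \<in> S" for G using S[OF that] by (simp add: pair_fin_digraph_def)
  have "code ` S \<subseteq> {..B} \<times> Pow ({..<B} \<times> {..<B})"
  proof
    fix x assume "x \<in> code ` S"
    then obtain G where G: "G \<in> S" "x = code G" by auto
    have "g G ` pverts G \<subseteq> {..<B}" using g[OF G(1)] S[OF G(1)] by (auto simp: bij_betw_def)
    moreover have "parcs G \<subseteq> pverts G \<times> pverts G" using wf[OF G(1)] by (auto simp: pair_wf_digraph_def)
    ultimately show "x \<in> {..B} \<times> Pow ({..<B} \<times> {..<B})" using S[OF G(1)] by (force simp: G(2) code_def)
  qed
  then have fin: "finite (code ` S)" by (rule finite_subset) simp
  have iso: "digraph_iso (with_proj G) (with_proj H)" if "G \<in> S" "H \<in> S" "code G = code H" for G H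
  proof (rule digraph_iso_if_same_relabelling[OF wf[OF that(1)] wf[OF that(2)]])
    show "inj_on (g G) (pverts G)" "inj_on (g H) (pverts H)" using g that by (auto simp: bij_betw_def)
    show "g G ` pverts G = g H ` pverts H" using g that by (simp add: bij_betw_def code_def)
    show "map_prod (g G) (g G) ` parcs G = map_prod (g H) (g H) ` parcs H" using that by (simp add: code_def)
  qed
  have same: "graph_iso_rel `` {G} = graph_iso_rel `` {H}" if "G \<in> S" "H \<in> S" "code G = code H" for G H
    using iso[OF that] iso[OF that(2,1) that(3)[symmetric]]
    by (auto simp: graph_iso_rel_def intro: digraph_iso_trans)
  define pick where "pick = (\<lambda>x. SOME G. G \<in> S \<and> code G = x)"
  have "S // graph_iso_rel \<subseteq> (\<lambda>x. graph_iso_rel `` {pick x}) ` code ` S"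
  proof
    fix C assume "C \<in> S // graph_iso_rel"
    then obtain G where G: "G \<in> S" "C = graph_iso_rel `` {G}" by (auto elim: quotientE)
    have "pick (code G) \<in> S \<and> code (pick (code G)) = code G"
      unfolding pick_def by (rule someI[of _ G]) (simp add: G)
    then have "C = graph_iso_rel `` {pick (code G)}" using same G by metis
    then show "C \<in> (\<lambda>x. graph_iso_rel `` {pick x}) ` code ` S" using G(1) by blast
  qed
  then show ?thesis using fin finite_subset by blast
qed

theorem corollary8p5:
  fixes k :: nat
  assumes "k \<ge> 1"
  shows "finite ({G :: 'a pair_pre_digraph.
      pair_graph G \<and> connected (with_proj G) \<and> bipartite G \<and> max_valency G \<le> k \<and>
      (\<exists>a \<in> pverts G. local_uniform_mixing G a)} // graph_iso_rel)"
proof (rule finite_iso_classes_of_bounded_order)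
  fix G :: "'a pair_pre_digraph"
  assume "G \<in> {G. pair_graph G \<and> connected (with_proj G) \<and> bipartite G \<and> max_valency G \<le> k \<and>
      (\<exists>a \<in> pverts G. local_uniform_mixing G a)}"
  then show "pair_fin_digraph G \<and> card (pverts G) \<le> (\<Sum>j<2 * k + 1. k ^ j)"
    using local_uniform_mixing_card_le[of G k] pair_graph_def pair_pseudo_graph_def by blast
qed

end
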